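(* Assume the standing assumption, the strong pseudomonotonicity assumption, the state-Lipschitz assumption on $h$, the time regularity assumption and the Lipschitz assumption on $f$ stated in the context. Then for each initial datum $x_0\in H$ there is a unique pair $(x,u)\in C([0,T];H)\times C([0,T];H)$ (mild solution pair) such that $$x(t)=e^{At}x_0+\int_0^t e^{A(t-s)}f(s,x(s),u(s))\,ds,\quad t\in[0,T],$$ $$u(t)\in h(t,x(t),u(t))-N_{K(t)}(Pu(t))\quad\text{for a.e. } t\in(0,T).$$ The state component $x$ satisfies the reduced mild equation $$x(t)=e^{At}x_0+\int_0^t e^{A(t-s)}\tilde f(s,x(s))\,ds,\quad t\in[0,T],\qquad \tilde f(t,z):=f(t,z,u_z(t)),$$ and the algebraic component is uniquely recovered through $u(t)=u_{x(t)}(t)$ for all $t\in[0,T]$, where for each frozen pair $(t,x(t))$ the value $u_{x(t)}(t)$ is unique and the trajectory $t\mapsto u_{x(t)}(t)$ is continuous.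
   Context: Let $H$ be a separable real Hilbert space with inner product $\langle\cdot,\cdot\rangle$ and norm $\|\cdot\|$, $\mathbb B_R(0)$ its closed ball of radius $R$ centered at $0$, and $T>0$. For nonempty closed convex $C\subset H$, $\mathrm{proj}_C$ is the metric projection onto $C$, and $N_C(y)=\{\xi\in H:\langle\xi,v-y\rangle\le0\ \forall v\in C\}$ if $y\in C$, $N_C(y)=\emptyset$ otherwise. A mapping $G:[0,T]\times X\to H$ ($X$ a separable metric space) is Carathéodory if $t\mapsto G(t,z)$ is strongly measurable for every $z\in X$, and $z\mapsto G(t,z)$ is continuous for almost every $t\in[0,T]$. Standing assumption: (i) $A:D(A)\subset H\to H$ is the infinitesimal generator of a strongly continuous semigroup $\{e^{At}\}_{t\ge0}$ on $H$; (ii) $P:H\to H$ is linear, bounded, self-adjoint and coercive (so $P$ is invertible with bounded inverse and $P^{-1}$ is strongly monotone); (iii) $K:[0,T]\rightrightarrows H$ is a set-valued mapping with nonempty, closed, convex values; (iv) $f,h:[0,T]\times H\times H\to H$ are Carathéodory mappings (with $X=H\times H$), and $t\mapsto f(t,0,0)$ belongs to $L^1(0,T;H)$. For $t\in[0,T]$, $x\in H$ define $F_{t,x}:H\to H$ by $F_{t,x}(y):=P^{-1}y-h(t,x,P^{-1}y)$. An operator $F:H\to H$ is strongly pseudomonotone on $C\subset H$ with modulus $m>0$ if for all $y,z\in C$: $\langle F(y),z-y\rangle\ge0$ implies $\langle F(z),z-y\rangle\ge m\|z-y\|^2$. Strong pseudomonotonicity assumption: there are $\gamma>0$ and $L_F>0$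 such that for every $t\in[0,T]$ and every $x\in H$, $F_{t,x}$ is strongly pseudomonotone on $K(t)$ with modulus $\gamma$ and Lipschitz continuous on $H$ with modulus $L_F$. State-Lipschitz assumption on $h$: there exists $\alpha_h>0$ such that $\|h(t,x_1,u)-h(t,x_2,u)\|\le\alpha_h\|x_1-x_2\|$ for all $t\in[0,T]$, $x_1,x_2,u\in H$. Time regularity assumption: (i) for every $R\ge0$ there is a continuous $\omega_{K,R}:\mathbb R_+\to\mathbb R_+$ with $\lim_{r\to0^+}\omega_{K,R}(r)=0$ and $\|\mathrm{proj}_{K(t_1)}(z)-\mathrm{proj}_{K(t_2)}(z)\|\le\omega_{K,R}(|t_1-t_2|)$ for all $t_1,t_2\in[0,T]$, $z\in\mathbb B_R(0)$; (ii) for every $R\ge0$ there is a continuous $\omega_{h,R}:\mathbb R_+\to\mathbb R_+$ with $\lim_{r\to0^+}\omega_{h,R}(r)=0$ and $\|h(t_1,x,u)-h(t_2,x,u)\|\le\omega_{h,R}(|t_1-t_2|)$ for all $t_1,t_2\in[0,T]$, $x,u\in\mathbb B_R(0)$. Lipschitz assumption on $f$: there are $\alpha_f>0$, $\beta_f>0$ such that $\|f(t,x_1,u_1)-f(t,x_2,u_2)\|\le\alpha_f\|x_1-x_2\|+\beta_f\|u_1-u_2\|$ for all $t\in[0,T]$, $x_1,x_2,u_1,u_2\in H$. Under the standing and strong pseudomonotonicity assumptions, for each $t\in[0,T]$ and $x\in H$ there is a unique $u\in H$, denoted $u_x(t)$, with $Pu\in K(t)$ and $\langle h(t,x,u)-u,v-Pu\rangle\le0$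 for all $v\in K(t)$. *)

theory Defs
  imports "HOL-Analysis.Analysis"
begin

text \<open>
  A separable real Hilbert space is a type of sort
  \<open>{real_inner, banach, second_countable_topology}\<close>. Mappings on \<open>[0,T]\<close> are total functions
  on \<^typ>\<open>real\<close> of which only the values on \<open>{0..T}\<close> are constrained.
\<close>

definition c0_semigroup :: "(real \<Rightarrow> 'a::real_normed_vector \<Rightarrow> 'a) \<Rightarrow> bool" where
  "c0_semigroup S \<longleftrightarrow>
     (\<forall>t\<ge>0. bounded_linear (S t)) \<and>
     (\<forall>x. S 0 x = x) \<and>
     (\<forall>s\<ge>0. \<forall>t\<ge>0. \<forall>x. S (s + t) x = S s (S t x)) \<and>
     (\<forall>x. ((\<lambda>t. S t x) \<longlongrightarrow> x) (at_right 0))"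

text \<open>An unbounded operator is given by its domain \<open>D\<close> and a function \<open>A\<close>, relevant only on \<open>D\<close>.\<close>

definition is_generator ::
  "'a::real_normed_vector set \<Rightarrow> ('a \<Rightarrow> 'a) \<Rightarrow> (real \<Rightarrow> 'a \<Rightarrow> 'a) \<Rightarrow> bool" where
  "is_generator D A S \<longleftrightarrow>
     D = {x. \<exists>y. ((\<lambda>r. (S r x - x) /\<^sub>R r) \<longlongrightarrow> y) (at_right 0)} \<and>
     (\<forall>x\<in>D. ((\<lambda>r. (S r x - x) /\<^sub>R r) \<longlongrightarrow> A x) (at_right 0))"

definition self_adjoint :: "('a::real_inner \<Rightarrow> 'a) \<Rightarrow> bool" where
  "self_adjoint P \<longleftrightarrow> (\<forall>x y. P x \<bullet> y = x \<bullet> P y)"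

definition coercive :: "('a::real_inner \<Rightarrow> 'a) \<Rightarrow> bool" where
  "coercive P \<longleftrightarrow> (\<exists>c>0. \<forall>x. c * (norm x)\<^sup>2 \<le> P x \<bullet> x)"

text \<open>
  The library's \<open>closest_point\<close> requires the class \<open>heine_borel\<close> and is thus restricted to finite
  dimension.
\<close>

definition metric_proj :: "'a::metric_space set \<Rightarrow> 'a \<Rightarrow> 'a" where
  "metric_proj C z = (THE p. p \<in> C \<and> (\<forall>v\<in>C. dist z p \<le> dist z v))"

definition normal_cone :: "'a::real_inner set \<Rightarrow> 'a \<Rightarrow> 'a set" where
  "normal_cone C y = (if y \<in> C then {\<xi>. \<forall>v\<in>C. \<xi> \<bullet> (v - y) \<le> 0} else {})"

definition strongly_pseudomonotone_on ::
  "'a::real_inner set \<Rightarrow> real \<Rightarrow> ('a \<Rightarrow> 'a) \<Rightarrow> bool" where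
  "strongly_pseudomonotone_on C m F \<longleftrightarrow> m > 0 \<and>
     (\<forall>y\<in>C. \<forall>z\<in>C. F y \<bullet> (z - y) \<ge> 0 \<longrightarrow> F z \<bullet> (z - y) \<ge> m * (norm (z - y))\<^sup>2)"

text \<open>
  Into a separable space, strong measurability (being an a.e. limit of simple functions) is
  measurability from the Lebesgue sets to the Borel sets.
\<close>

definition caratheodory ::
  "real \<Rightarrow> (real \<Rightarrow> 'b::{metric_space, second_countable_topology} \<Rightarrow>
     'a::{real_normed_vector, second_countable_topology}) \<Rightarrow> bool" where
  "caratheodory T G \<longleftrightarrow>
     (\<forall>z. (\<lambda>t. G t z) \<in> borel_measurable (lebesgue_on {0..T})) \<and>
     (AE t in lebesgue_on {0..T}. continuous_on UNIV (G t))"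

definition modulus :: "(real \<Rightarrow> real) \<Rightarrow> bool" where
  "modulus \<omega> \<longleftrightarrow> continuous_on {0..} \<omega> \<and> (\<forall>r\<ge>0. \<omega> r \<ge> 0) \<and> (\<omega> \<longlongrightarrow> 0) (at_right 0)"

definition time_regular_sets :: "real \<Rightarrow> (real \<Rightarrow> 'a::real_inner set) \<Rightarrow> bool" where
  "time_regular_sets T K \<longleftrightarrow> (\<forall>R\<ge>0. \<exists>\<omega>. modulus \<omega> \<and>
     (\<forall>t1\<in>{0..T}. \<forall>t2\<in>{0..T}. \<forall>z\<in>cball 0 R.
        norm (metric_proj (K t1) z - metric_proj (K t2) z) \<le> \<omega> \<bar>t1 - t2\<bar>))"

definition time_regular_map :: "real \<Rightarrow> (real \<Rightarrow> 'a::real_inner \<Rightarrow> 'a \<Rightarrow> 'a) \<Rightarrow> bool" where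
  "time_regular_map T h \<longleftrightarrow> (\<forall>R\<ge>0. \<exists>\<omega>. modulus \<omega> \<and>
     (\<forall>t1\<in>{0..T}. \<forall>t2\<in>{0..T}. \<forall>x\<in>cball 0 R. \<forall>u\<in>cball 0 R.
        norm (h t1 x u - h t2 x u) \<le> \<omega> \<bar>t1 - t2\<bar>))"

definition vi_operator ::
  "('a::real_inner \<Rightarrow> 'a) \<Rightarrow> (real \<Rightarrow> 'a \<Rightarrow> 'a \<Rightarrow> 'a) \<Rightarrow> real \<Rightarrow> 'a \<Rightarrow> 'a \<Rightarrow> 'a" where
  "vi_operator P h t x y = inv P y - h t x (inv P y)"

definition frozen_solution ::
  "('a::real_inner \<Rightarrow> 'a) \<Rightarrow> (real \<Rightarrow> 'a set) \<Rightarrow> (real \<Rightarrow> 'a \<Rightarrow> 'a \<Rightarrow> 'a) \<Rightarrow>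
     real \<Rightarrow> 'a \<Rightarrow> 'a \<Rightarrow> bool" where
  "frozen_solution P K h t x u \<longleftrightarrow>
     P u \<in> K t \<and> (\<forall>v\<in>K t. (h t x u - u) \<bullet> (v - P u) \<le> 0)"

text \<open>\<open>frozen_value P K h t x\<close> is \<open>u\<^sub>x(t)\<close>.\<close>

definition frozen_value ::
  "('a::real_inner \<Rightarrow> 'a) \<Rightarrow> (real \<Rightarrow> 'a set) \<Rightarrow> (real \<Rightarrow> 'a \<Rightarrow> 'a \<Rightarrow> 'a) \<Rightarrow> real \<Rightarrow> 'a \<Rightarrow> 'a" where
  "frozen_value P K h t x = (THE u. frozen_solution P K h t x u)"

definition reduced_rhs ::
  "('a::real_inner \<Rightarrow> 'a) \<Rightarrow> (real \<Rightarrow> 'a set) \<Rightarrow> (real \<Rightarrow> 'a \<Rightarrow> 'a \<Rightarrow> 'a) \<Rightarrow>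
     (real \<Rightarrow> 'a \<Rightarrow> 'a \<Rightarrow> 'a) \<Rightarrow> real \<Rightarrow> 'a \<Rightarrow> 'a" where
  "reduced_rhs P K h f t z = f t z (frozen_value P K h t z)"

text \<open>
  Integrability is stated explicitly, since the Bochner integral of a non-integrable function
  is 0 by convention.
\<close>

definition mild_equation ::
  "real \<Rightarrow> (real \<Rightarrow> 'a \<Rightarrow> 'a) \<Rightarrow> 'a \<Rightarrow> (real \<Rightarrow> 'a) \<Rightarrow>
     (real \<Rightarrow> 'a::{banach, second_countable_topology}) \<Rightarrow> bool" where
  "mild_equation T S x0 g x \<longleftrightarrow> (\<forall>t\<in>{0..T}.
     set_integrable lebesgue {0..t} (\<lambda>s. S (t - s) (g s)) \<and>
     x t = S t x0 + (LINT s:{0..t}|lebesgue. S (t - s) (g s)))"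

definition mild_solution_pair ::
  "real \<Rightarrow> (real \<Rightarrow> 'a \<Rightarrow> 'a) \<Rightarrow> ('a \<Rightarrow> 'a) \<Rightarrow> (real \<Rightarrow> 'a set) \<Rightarrow> (real \<Rightarrow> 'a \<Rightarrow> 'a \<Rightarrow> 'a) \<Rightarrow>
     (real \<Rightarrow> 'a \<Rightarrow> 'a \<Rightarrow> 'a) \<Rightarrow> 'a \<Rightarrow> (real \<Rightarrow> 'a) \<Rightarrow>
     (real \<Rightarrow> 'a::{real_inner, banach, second_countable_topology}) \<Rightarrow> bool" where
  "mild_solution_pair T S P K f h x0 x u \<longleftrightarrow>
     continuous_on {0..T} x \<and> continuous_on {0..T} u \<and>
     mild_equation T S x0 (\<lambda>s. f s (x s) (u s)) x \<and>
     (AE t in lebesgue_on {0<..<T}.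
        u t \<in> (\<lambda>\<xi>. h t (x t) (u t) - \<xi>) ` normal_cone (K t) (P (u t)))"

end

theory Submission
  imports Defs
begin

text \<open>
  The substitution \<open>y = P u\<close> turns the inclusion into a variational inequality over \<open>K t\<close> for the strongly
  pseudomonotone operator \<open>y \<mapsto> P\<^sup>-\<^sup>1 y - h t x (P\<^sup>-\<^sup>1 y)\<close>. Its solution exists because the candidate
  sets of the Minty formulation are intersections of \<open>K t\<close> with balls, hence bounded, closed and convex,
  so a KKM principle for convex sets, which needs only hyperplane separation and no fixed point theorem,
  gives them a common point. Testing two such inequalities against each other shows that the solution is
  unique, Lipschitz in \<open>x\<close> uniformly in \<open>t\<close>, and continuous in \<open>t\<close>. Eliminating \<open>u\<close> leaves a semilinear
  evolution equation with a Lipschitz right-hand side, which a weighted contraction argument solves. For an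
  arbitrary solution pair, both \<open>u\<close> and the frozen solution along \<open>x\<close> are continuous, so agreeing almost
  everywhere they agree on all of \<open>[0,T]\<close>.
\<close>

section \<open>Closed convex sets in a Hilbert space\<close>

text \<open>In infinite dimension closed balls are not norm compact, and \<open>F\<close> is only
  norm continuous, so the sets of \<open>y\<close> with \<open>0 \<le> F y \<bullet> (v - y)\<close>
  need be neither convex nor weakly closed. Strong pseudomonotonicity trades this condition for a
  quadratic one with \<open>F\<close> evaluated at the test point \<open>v\<close>, whose solution
  set in \<open>y\<close> is a ball. Weak compactness is replaced by norm-minimal points of
  decreasing convex sets; separability reduces an arbitrary family to a countable one. Dependence on
  time is harder than dependence on the state: the constraint set moves, so the solution at one time
  is no admissible test point at another, and the moduli depend on a radius that has to be bounded a
  priori. The data \<open>f\<close> is merely measurable in time, so integrability along a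
  continuous curve needs its own argument. No smallness relation links the constants, hence the
  exponential weight.\<close>

lemma dist_near_minimizers_le:
  fixes z p q :: "'a::real_inner"
  assumes C: "convex C" and p: "p \<in> C" and q: "q \<in> C"
    and d: "\<And>v. v \<in> C \<Longrightarrow> d \<le> dist z v" "0 \<le> d"
  shows "(dist p q)\<^sup>2 \<le> 2 * (dist z p)\<^sup>2 + 2 * (dist z q)\<^sup>2 - 4 * d\<^sup>2"
proof -
  \<comment> \<open>The midpoint stays in \<open>C\<close>, so its distance from \<open>z\<close> is
    at least \<open>d\<close>; the parallelogram law converts this into the bound on
    \<open>dist p q\<close>.\<close>
  define m where "m = (1/2) *\<^sub>R p + (1/2) *\<^sub>R q"
  have "m \<in> C"
    unfolding m_def using C p q by (intro convexD) auto
  hence "d\<^sup>2 \<le> (dist z m)\<^sup>2"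
    using d by (intro power_mono) auto
  moreover have "4 * (dist z m)\<^sup>2 + (dist p q)\<^sup>2 = 2 * (dist z p)\<^sup>2 + 2 * (dist z q)\<^sup>2"
    unfolding m_def dist_norm power2_norm_eq_inner
    by (simp add: inner_diff inner_add inner_commute algebra_simps)
  ultimately show ?thesis by linarith
qed

lemma ex1_closest_point:
  fixes z :: "'a::{real_inner, banach}"
  assumes C: "closed C" "convex C" "C \<noteq> {}"
  shows "\<exists>!p. p \<in> C \<and> (\<forall>v\<in>C. dist z p \<le> dist z v)"
proof -
  define d where "d = infdist z C"
  have d: "d \<le> dist z v" if "v \<in> C" for v
    unfolding d_def using that by (rule infdist_le)
  have d0: "0 \<le> d"
    unfolding d_def by (rule infdist_nonneg)
  have "\<exists>v\<in>C. dist z v < d + 1 / Suc n" for n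
  proof -
    have "d < d + 1 / Suc n" by simp
    thus ?thesis
      unfolding d_def infdist_notempty[OF C(3)] by (subst (asm) cINF_less_iff) (use C in auto)
  qed
  then obtain p where p: "\<And>n. p n \<in> C" "\<And>n. dist z (p n) < d + 1 / Suc n"
    by metis
  have lim: "(\<lambda>n. dist z (p n)) \<longlonglongrightarrow> d"
  proof (rule tendsto_sandwich[OF _ _ tendsto_const])
    show "(\<lambda>n. d + 1 / Suc n) \<longlonglongrightarrow> d"
      using tendsto_add[OF tendsto_const LIMSEQ_inverse_real_of_nat, of d]
      by (simp add: inverse_eq_divide)
  qed (use d p in \<open>auto intro!: always_eventually less_imp_le\<close>)
  have "Cauchy p"
  proof (rule metric_CauchyI)
    fix e :: real assume "0 < e"
    have "(\<lambda>n. (dist z (p n))\<^sup>2) \<longlonglongrightarrow> d\<^sup>2"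
      using lim by (intro tendsto_intros)
    \<comment> \<open>If both squared distances are below \<open>d\<close> squared plus a quarter of
      \<open>e\<close> squared, the midpoint estimate leaves exactly \<open>e\<close>
      squared.\<close>
    moreover have "d\<^sup>2 < d\<^sup>2 + e\<^sup>2 / 4"
      using \<open>0 < e\<close> by simp
    ultimately have "\<forall>\<^sub>F n in sequentially. (dist z (p n))\<^sup>2 < d\<^sup>2 + e\<^sup>2 / 4"
      by (rule order_tendstoD)
    then obtain N where N: "\<And>n. N \<le> n \<Longrightarrow> (dist z (p n))\<^sup>2 < d\<^sup>2 + e\<^sup>2 / 4"
      by (auto simp: eventually_sequentially)
    have "dist (p m) (p n) < e" if "N \<le> m" "N \<le> n" for m n
    proof -
      have "(dist (p m) (p n))\<^sup>2 < e\<^sup>2"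
        using dist_near_minimizers_le[OF C(2) p(1)[of m] p(1)[of n] d d0] N[OF that(1)] N[OF that(2)]
        by linarith
      thus ?thesis
        using \<open>0 < e\<close> by (simp add: power2_less_imp_less)
    qed
    thus "\<exists>N. \<forall>m\<ge>N. \<forall>n\<ge>N. dist (p m) (p n) < e" by blast
  qed
  then obtain l where l: "p \<longlonglongrightarrow> l"
    using Cauchy_convergent_iff convergent_def by blast
  have "l \<in> C"
    using closed_sequentially[OF C(1)] p(1) l by blast
  moreover have "dist z l = d"
    using LIMSEQ_unique[OF lim] tendsto_dist[OF tendsto_const l, of z] by simp
  ultimately have "l \<in> C \<and> (\<forall>v\<in>C. dist z l \<le> dist z v)"
    using d by simp
  moreover have "p = q" if "p \<in> C \<and> (\<forall>v\<in>C. dist z p \<le> dist z v)"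
    "q \<in> C \<and> (\<forall>v\<in>C. dist z q \<le> dist z v)" for p q
  proof -
    have "dist z p = dist z q"
      using that by (meson antisym)
    hence "(dist p q)\<^sup>2 \<le> 0"
      using dist_near_minimizers_le[OF C(2), of p q "dist z p" z] that by simp
    thus ?thesis by simp
  qed
  ultimately show ?thesis by blast
qed

lemma metric_proj:
  fixes z :: "'a::{real_inner, banach}"
  assumes "closed C" "convex C" "C \<noteq> {}"
  shows metric_proj_mem: "metric_proj C z \<in> C"
    and metric_proj_le: "v \<in> C \<Longrightarrow> dist z (metric_proj C z) \<le> dist z v"
  using theI'[OF ex1_closest_point[OF assms, of z]] unfolding metric_proj_def by auto

lemma metric_proj_self:
  fixes z :: "'a::{real_inner, banach}"
  assumes "closed C" "convex C" "z \<in> C"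
  shows "metric_proj C z = z"
proof -
  have "dist z (metric_proj C z) \<le> dist z z"
    using assms by (intro metric_proj_le) auto
  thus ?thesis by simp
qed

text \<open>A positive inner product would allow a small step from \<open>p\<close> towards
  \<open>v\<close> that stays in \<open>C\<close> and comes closer to \<open>z\<close>.\<close>

lemma closest_point_inner_le:
  fixes z :: "'a::real_inner"
  assumes "convex C" "p \<in> C" "\<And>v. v \<in> C \<Longrightarrow> dist z p \<le> dist z v" "v \<in> C"
  shows "(z - p) \<bullet> (v - p) \<le> 0"
proof (rule ccontr)
  assume "\<not> ?thesis"
  hence pos: "0 < (z - p) \<bullet> (v - p)" by simp
  obtain u where u: "0 < u" "u \<le> 1" "dist (p + u *\<^sub>R (v - p)) z < dist p z"
    using closer_point_lemma[OF pos] by (auto simp: dist_commute)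
  have "p + u *\<^sub>R (v - p) = (1 - u) *\<^sub>R p + u *\<^sub>R v"
    by (simp add: algebra_simps)
  moreover have "(1 - u) *\<^sub>R p + u *\<^sub>R v \<in> C"
    using assms u by (intro convexD) auto
  ultimately show False
    using assms(3)[of "p + u *\<^sub>R (v - p)"] u by (simp add: dist_commute)
qed

section \<open>Separation and intersection principles for convex sets\<close>

lemma separating_hyperplane_compact_closed_hilbert:
  fixes D G :: "'a::{real_inner, banach} set"
  assumes D: "compact D" "convex D" "D \<noteq> {}" and G: "closed G" "convex G" "G \<noteq> {}"
    and disj: "D \<inter> G = {}"
  shows "\<exists>a b. (\<forall>x\<in>D. b < a \<bullet> x) \<and> (\<forall>x\<in>G. a \<bullet> x < b)"
proof -
  \<comment> \<open>Compactness of \<open>D\<close> yields a pair \<open>p\<close>, \<open>q\<close>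
    realizing the distance between the two sets; \<open>p - q\<close> is the normal of the
    separating hyperplane.\<close>
  have "continuous_on D (\<lambda>x. infdist x G)"
    by (intro continuous_intros)
  then obtain p where p: "p \<in> D" "\<And>x. x \<in> D \<Longrightarrow> infdist p G \<le> infdist x G"
    using continuous_attains_inf[OF D(1,3)] by blast
  define q where "q = metric_proj G p"
  have q: "q \<in> G" "\<And>v. v \<in> G \<Longrightarrow> dist p q \<le> dist p v"
    unfolding q_def using metric_proj[OF G] by auto
  define a where "a = p - q"
  have "a \<noteq> 0"
    using p(1) q(1) disj by (auto simp: a_def)
  hence a: "0 < a \<bullet> a" by simp
  \<comment> \<open>The pair is optimal from both sides: \<open>p\<close> is also the point of
    \<open>D\<close> nearest to \<open>q\<close>.\<close>
  have qp: "dist q p \<le> dist q v" if "v \<in> D" for v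
  proof -
    have "dist p q \<le> infdist p G"
      unfolding infdist_notempty[OF G(3)] using G q by (intro cINF_greatest) auto
    also have "\<dots> \<le> infdist v G" by (rule p(2)[OF that])
    also have "\<dots> \<le> dist v q" by (rule infdist_le[OF q(1)])
    finally show ?thesis by (simp add: dist_commute)
  qed
  have "(p - q) \<bullet> (v - q) \<le> 0" if "v \<in> G" for v
    by (rule closest_point_inner_le[OF G(2) q that])
  hence 1: "a \<bullet> v \<le> a \<bullet> q" if "v \<in> G" for v
    using that by (fastforce simp: a_def inner_diff_right)
  have "(q - p) \<bullet> (v - p) \<le> 0" if "v \<in> D" for v
    by (rule closest_point_inner_le[OF D(2) p(1) qp that])
  hence 2: "a \<bullet> p \<le> a \<bullet> v" if "v \<in> D" for v
    using that by (fastforce simp: a_def inner_diff)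
  have "a \<bullet> q < a \<bullet> p"
    using a by (simp add: a_def inner_diff_right)
  then obtain b where "a \<bullet> q < b" "b < a \<bullet> p"
    using dense by blast
  thus ?thesis
    using 1 2 by (intro exI[of _ a] exI[of _ b]) force
qed

text \<open>This does the work of weak compactness. The norm-minimal points of decreasing finite
  intersections have increasing bounded norms, and convexity turns convergence of the norms into
  convergence of the points.\<close>

lemma bounded_closed_convex_Inter_nonempty:
  fixes \<F> :: "'a::{real_inner, banach, second_countable_topology} set set"
  assumes cl: "\<And>C. C \<in> \<F> \<Longrightarrow> closed C" and cv: "\<And>C. C \<in> \<F> \<Longrightarrow> convex C"
    and B: "B \<in> \<F>" "bounded B"
    and fin: "\<And>\<G>. finite \<G> \<Longrightarrow> \<G> \<subseteq> \<F> \<Longrightarrow> \<G> \<noteq> {} \<Longrightarrow> \<Inter>\<G> \<noteq> {}"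
  shows "\<Inter>\<F> \<noteq> {}"
proof -
  \<comment> \<open>Lindelof applied to the complements gives a countable subfamily with the same
    intersection.\<close>
  have "\<And>S. S \<in> uminus ` \<F> \<Longrightarrow> open S"
    using cl by auto
  then obtain \<H> where \<H>: "\<H> \<subseteq> uminus ` \<F>" "countable \<H>" "\<Union>\<H> = \<Union>(uminus ` \<F>)"
    by (rule Lindelof)
  obtain \<C> where \<C>: "\<C> \<subseteq> \<F>" "countable \<C>" "\<H> = uminus ` \<C>"
    using countable_subset_image[of \<H> uminus \<F>] \<H> by auto
  have Inter_eq: "\<Inter>\<C> = \<Inter>\<F>"
    using \<H>(3) unfolding \<C>(3) uminus_Inf[symmetric] by simp
  define c where "c = from_nat_into (insert B \<C>)"
  have range_c: "range c = insert B \<C>"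
    unfolding c_def using \<C>(2) by (intro range_from_nat_into) auto
  \<comment> \<open>Intersecting with \<open>B\<close> keeps every \<open>X n\<close> inside one
    bounded set, which bounds the norms of the minimal points.\<close>
  define X where "X n = B \<inter> (\<Inter>k\<le>n. c k)" for n
  have c: "c k \<in> \<F>" for k
    using range_c \<C>(1) B(1) by auto
  have X: "closed (X n)" "convex (X n)" "X n \<noteq> {}" for n
  proof -
    show "closed (X n)" "convex (X n)"
      unfolding X_def using c cl cv B by (auto intro!: closed_Int closed_INT convex_Int convex_INT)
    have "\<Inter>(insert B (c ` {..n})) \<noteq> {}"
      using c B by (intro fin) auto
    thus "X n \<noteq> {}"
      unfolding X_def by simp
  qed
  have anti: "X n \<subseteq> X m" if "m \<le> n" for m n
    unfolding X_def using that by force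
  define p where "p n = metric_proj (X n) 0" for n
  have p: "p n \<in> X n" "\<And>v. v \<in> X n \<Longrightarrow> dist 0 (p n) \<le> dist 0 v" for n
    unfolding p_def using metric_proj_mem[OF X] metric_proj_le[OF X] by blast+
  obtain R where R: "\<And>x. x \<in> B \<Longrightarrow> norm x \<le> R"
    using B(2) by (auto simp: bounded_iff)
  have pm: "p n \<in> X m" if "m \<le> n" for m n
    using p(1)[of n] anti[OF that] by auto
  have mono: "norm (p m) \<le> norm (p n)" if "m \<le> n" for m n
    using p(2)[OF pm[OF that]] by simp
  have sq_mono: "(norm (p m))\<^sup>2 \<le> (norm (p n))\<^sup>2" if "m \<le> n" for m n
    using mono[OF that] by (intro power_mono) auto
  have "(norm (p n))\<^sup>2 \<le> R\<^sup>2" for n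
    using R[of "p n"] p(1)[of n] by (intro power_mono) (auto simp: X_def)
  hence "Bseq (\<lambda>n. (norm (p n))\<^sup>2)"
    by (intro BseqI'[of _ "R\<^sup>2"]) auto
  moreover have "monoseq (\<lambda>n. (norm (p n))\<^sup>2)"
    using sq_mono by (simp add: monoseq_def)
  ultimately have "convergent (\<lambda>n. (norm (p n))\<^sup>2)"
    by (rule Bseq_monoseq_convergent)
  hence Cau: "Cauchy (\<lambda>n. (norm (p n))\<^sup>2)"
    by (rule convergent_Cauchy)
  \<comment> \<open>For \<open>m \<le> n\<close> both points lie in \<open>X m\<close> and
    \<open>p m\<close> is minimal there, so the midpoint estimate with center 0 and
    \<open>d = norm (p m)\<close> leaves twice the difference of the squared norms.\<close>
  have step: "(dist (p m) (p n))\<^sup>2 \<le> 2 * \<bar>(norm (p n))\<^sup>2 - (norm (p m))\<^sup>2\<bar>" for m n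
  proof (induction m n rule: linorder_wlog)
    case (le m n)
    show ?case
      using dist_near_minimizers_le[OF X(2) p(1)[of m] pm[OF le] p(2)[of _ m], simplified]
        sq_mono[OF le] by simp
  next
    case (sym m n)
    then show ?case by (simp add: dist_commute abs_minus_commute)
  qed
  have "Cauchy p"
  proof (rule metric_CauchyI)
    fix e :: real assume "0 < e"
    obtain N where N: "\<And>m n. N \<le> m \<Longrightarrow> N \<le> n \<Longrightarrow> \<bar>(norm (p n))\<^sup>2 - (norm (p m))\<^sup>2\<bar> < e\<^sup>2 / 2"
      using metric_CauchyD[OF Cau, of "e\<^sup>2 / 2"] \<open>0 < e\<close> by (auto simp: dist_real_def)
    have "dist (p m) (p n) < e" if "N \<le> m" "N \<le> n" for m n
    proof -
      have "(dist (p m) (p n))\<^sup>2 < e\<^sup>2"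
        using le_less_trans[OF step[of m n], of "e\<^sup>2"] N[OF that] by simp
      thus ?thesis using \<open>0 < e\<close> by (simp add: power2_less_imp_less)
    qed
    thus "\<exists>N. \<forall>m\<ge>N. \<forall>n\<ge>N. dist (p m) (p n) < e" by blast
  qed
  then obtain l where l: "p \<longlonglongrightarrow> l"
    using Cauchy_convergent_iff convergent_def by blast
  have "l \<in> X m" for m
    using closed_sequentially[OF X(1)[of m], of "\<lambda>n. p (n + m)" l]
      LIMSEQ_ignore_initial_segment[OF l, of m] pm[of m] by simp
  hence "l \<in> c m" for m
    by (auto simp: X_def)
  hence "l \<in> \<Inter>(insert B \<C>)"
    unfolding range_c[symmetric] by auto
  thus ?thesis using Inter_eq by auto
qed

text \<open>
  If the sets had no common point, a hyperplane separating one of them from the intersection of the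
  others would meet those others in a smaller family with the same properties.
\<close>

lemma convex_Union_Inter_nonempty:
  fixes G :: "'i \<Rightarrow> 'a::{real_inner, banach} set"
  assumes "finite I" "I \<noteq> {}"
    and "\<And>i. i \<in> I \<Longrightarrow> compact (G i)" "\<And>i. i \<in> I \<Longrightarrow> convex (G i)"
    and "convex (\<Union>i\<in>I. G i)"
    and "\<And>i. i \<in> I \<Longrightarrow> (\<Union>i\<in>I. G i) \<inter> (\<Inter>j\<in>I - {i}. G j) \<noteq> {}"
  shows "(\<Inter>i\<in>I. G i) \<noteq> {}"
  using assms
proof (induction arbitrary: G rule: finite_ne_induct)
  case (singleton n)
  then show ?case by auto
next
  case (insert n I)
  let ?X = "\<Union>i\<in>insert n I. G i"
  show ?case
  proof (rule ccontr)
    assume neg: "\<not> ?case"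
    define D where "D = (\<Inter>i\<in>I. G i)"
    have ID: "insert n I - {n} = I" using insert.hyps by auto
    have "?X \<inter> D \<noteq> {}"
      using insert.prems(4)[of n] unfolding ID D_def by blast
    hence D_ne: "D \<noteq> {}" by blast
    obtain i0 where i0: "i0 \<in> I" using insert.hyps by auto
    have "closed D"
      unfolding D_def using insert.prems(1) by (intro closed_INT ballI compact_imp_closed) auto
    moreover have "D = G i0 \<inter> D" using i0 by (auto simp: D_def)
    ultimately have "compact D"
      using insert.prems(1)[of i0] i0 by (metis compact_Int_closed insertI2)
    moreover have "convex D"
      unfolding D_def using insert.prems(2) by (intro convex_INT) auto
    moreover have "closed (G n)" "convex (G n)"
      using insert.prems by (auto intro: compact_imp_closed)
    moreover have "G n \<noteq> {}"
    proof -
      obtain i where "i \<in> I" using insert.hyps by auto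
      hence "n \<in> insert n I - {i}" using insert.hyps by auto
      moreover have "(\<Inter>j\<in>insert n I - {i}. G j) \<noteq> {}"
        using insert.prems(4)[of i] \<open>i \<in> I\<close> by auto
      ultimately show ?thesis by (metis INT_E empty_iff equals0I)
    qed
    moreover have "D \<inter> G n = {}"
      using neg unfolding D_def by auto
    ultimately obtain a b where ab: "\<And>x. x \<in> D \<Longrightarrow> b < a \<bullet> x" "\<And>x. x \<in> G n \<Longrightarrow> a \<bullet> x < b"
      using separating_hyperplane_compact_closed_hilbert[of D "G n"] D_ne by blast
    define H where "H = {x. a \<bullet> x = b}"
    have H: "closed H" "convex H"
      unfolding H_def by (auto simp: closed_hyperplane convex_hyperplane)
    \<comment> \<open>\<open>G n\<close> lies strictly on one side of \<open>H\<close>, so it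
      contributes nothing to the slice of the union; this is how the index \<open>n\<close>
      disappears.\<close>
    have Un: "(\<Union>i\<in>I. G i \<inter> H) = ?X \<inter> H"
      using ab(2) by (force simp: H_def)
    have "(\<Inter>i\<in>I. G i \<inter> H) \<noteq> {}"
    proof (rule insert.IH)
      show "compact (G i \<inter> H)" "convex (G i \<inter> H)" if "i \<in> I" for i
        using that insert.prems H by (auto intro: compact_Int_closed convex_Int)
      show "convex (\<Union>i\<in>I. G i \<inter> H)"
        unfolding Un using insert.prems(3) H by (intro convex_Int)
      show "(\<Union>i\<in>I. G i \<inter> H) \<inter> (\<Inter>j\<in>I - {i}. G j \<inter> H) \<noteq> {}" if i: "i \<in> I" for i
      proof -
        \<comment> \<open>\<open>Y\<close> is convex and has points on both sides of
          \<open>H\<close>: one in \<open>D\<close>, one in \<open>G n\<close>. Connectedness then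
          produces a point of \<open>Y\<close> on \<open>H\<close>.\<close>
        define Y where "Y = ?X \<inter> (\<Inter>j\<in>I - {i}. G j)"
        have "convex Y"
          unfolding Y_def using insert.prems by (intro convex_Int convex_INT) auto
        obtain p where "p \<in> D" using D_ne by auto
        hence p: "p \<in> Y" "b < a \<bullet> p"
          using ab i by (auto simp: Y_def D_def)
        have "insert n (I - {i}) = insert n I - {i}"
          using i insert.hyps by auto
        then obtain q where "q \<in> ?X" "q \<in> (\<Inter>j\<in>insert n (I - {i}). G j)"
          using insert.prems(4)[of i] i by auto
        hence q: "q \<in> Y" "a \<bullet> q < b"
          using ab by (auto simp: Y_def)
        have "connected Y" using \<open>convex Y\<close> by (rule convex_connected)
        moreover have "continuous_on Y ((\<bullet>) a)"
          by (intro continuous_intros)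
        ultimately have "connected ((\<bullet>) a ` Y)"
          by (intro connected_continuous_image)
        hence "b \<in> (\<bullet>) a ` Y"
          using p q by (intro connectedD_interval[of _ "a \<bullet> q" "a \<bullet> p" b]) auto
        then obtain y where "y \<in> Y" "y \<in> H" by (auto simp: H_def)
        thus ?thesis unfolding Un by (auto simp: Y_def)
      qed
    qed
    then obtain y where "y \<in> D" "y \<in> H"
      using insert.hyps by (auto simp: D_def)
    thus False using ab(1) by (auto simp: H_def)
  qed
qed

text \<open>Cutting each set down to the polytope \<open>convex hull V\<close> makes it compact and
  makes the union equal to the polytope, hence convex. That all sets but one have a common point in
  it is the induction hypothesis for \<open>V - {i}\<close>.\<close>

lemma KKM_convex:
  fixes \<Phi> :: "'a \<Rightarrow> 'a::{real_inner, banach} set"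
  assumes "finite V" "V \<noteq> {}"
    and "\<And>v. v \<in> V \<Longrightarrow> closed (\<Phi> v)" "\<And>v. v \<in> V \<Longrightarrow> convex (\<Phi> v)"
    and "\<And>W. W \<subseteq> V \<Longrightarrow> W \<noteq> {} \<Longrightarrow> convex hull W \<subseteq> (\<Union>v\<in>W. \<Phi> v)"
  shows "convex hull V \<inter> (\<Inter>v\<in>V. \<Phi> v) \<noteq> {}"
  using assms
proof (induction V rule: finite_psubset_induct)
  case (psubset V)
  define G where "G v = convex hull V \<inter> \<Phi> v" for v
  have Un: "(\<Union>v\<in>V. G v) = convex hull V"
    using psubset.prems(4)[of V] psubset.prems(1) by (auto simp: G_def)
  have "(\<Inter>v\<in>V. G v) \<noteq> {}"
  proof (rule convex_Union_Inter_nonempty)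
    show "compact (G v)" "convex (G v)" if "v \<in> V" for v
      unfolding G_def using that psubset
      by (auto intro!: compact_Int_closed convex_Int finite_imp_compact_convex_hull convex_convex_hull)
    show "convex (\<Union>v\<in>V. G v)" unfolding Un by (rule convex_convex_hull)
    show "(\<Union>i\<in>V. G i) \<inter> (\<Inter>j\<in>V - {i}. G j) \<noteq> {}" if "i \<in> V" for i
    proof (cases "V - {i} = {}")
      case True
      thus ?thesis unfolding Un True using that by (auto intro: hull_inc)
    next
      case False
      have "convex hull (V - {i}) \<inter> (\<Inter>v\<in>V - {i}. \<Phi> v) \<noteq> {}"
        using that False psubset.prems by (intro psubset.IH) auto
      moreover have "convex hull (V - {i}) \<subseteq> convex hull V"
        by (intro hull_mono) auto
      ultimately obtain y where "y \<in> convex hull V" "\<forall>v\<in>V - {i}. y \<in> \<Phi> v"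
        by blast
      hence "y \<in> (\<Inter>j\<in>V - {i}. G j)" by (simp add: G_def)
      with \<open>y \<in> convex hull V\<close> show ?thesis unfolding Un by blast
    qed
  qed (use psubset in auto)
  thus ?case using psubset.prems(1) by (auto simp: G_def)
qed

section \<open>Strongly pseudomonotone variational inequalities\<close>

definition vi_solution :: "('a::real_inner \<Rightarrow> 'a) \<Rightarrow> 'a set \<Rightarrow> 'a \<Rightarrow> bool" where
  "vi_solution F C y \<longleftrightarrow> y \<in> C \<and> (\<forall>v\<in>C. 0 \<le> F y \<bullet> (v - y))"

text \<open>The Minty form: \<open>F\<close> is now evaluated at the known test point instead of the
  unknown solution.\<close>

lemma vi_solution_strong_ineq:
  assumes "strongly_pseudomonotone_on C m F" "vi_solution F C y" "v \<in> C"
  shows "m * (norm (v - y))\<^sup>2 \<le> F v \<bullet> (v - y)"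
  using assms unfolding strongly_pseudomonotone_on_def vi_solution_def by auto

lemma vi_solution_exists:
  fixes F :: "'a::{real_inner, banach, second_countable_topology} \<Rightarrow> 'a"
  assumes C: "closed C" "convex C" "C \<noteq> {}"
    and F: "strongly_pseudomonotone_on C m F" "continuous_on C F"
  shows "\<exists>y. vi_solution F C y"
proof -
  have m: "0 < m" using F(1) by (simp add: strongly_pseudomonotone_on_def)
  define M where "M v = C \<inter> {y. m * (norm (v - y))\<^sup>2 \<le> F v \<bullet> (v - y)}" for v
  \<comment> \<open>Completing the square in \<open>v - y\<close> exhibits the quadratic inequality
    as a ball, so closedness, convexity and boundedness come at once.\<close>
  have M_ball: "{y. m * (norm (v - y))\<^sup>2 \<le> F v \<bullet> (v - y)} =
      cball (v - (1 / (2 * m)) *\<^sub>R F v) (norm (F v) / (2 * m))" for v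
  proof -
    have "(m * (norm (v - y))\<^sup>2 \<le> F v \<bullet> (v - y)) \<longleftrightarrow>
        dist (v - (1 / (2 * m)) *\<^sub>R F v) y \<le> norm (F v) / (2 * m)" for y
    proof -
      have "dist (v - (1 / (2 * m)) *\<^sub>R F v) y \<le> norm (F v) / (2 * m) \<longleftrightarrow>
         (dist (v - (1 / (2 * m)) *\<^sub>R F v) y)\<^sup>2 \<le> (norm (F v) / (2 * m))\<^sup>2"
        using m by (simp add: abs_le_square_iff[symmetric])
      also have "(dist (v - (1 / (2 * m)) *\<^sub>R F v) y)\<^sup>2 =
         (norm ((v - y) - (1 / (2 * m)) *\<^sub>R F v))\<^sup>2"
        by (simp add: dist_norm algebra_simps)
      also have "\<dots> = (norm (v - y))\<^sup>2 - (1 / m) * (F v \<bullet> (v - y)) + (norm (F v) / (2 * m))\<^sup>2"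
        unfolding power_divide power2_norm_eq_inner
        by (simp add: inner_diff inner_commute algebra_simps power2_eq_square)
      also have "(\<dots> \<le> (norm (F v) / (2 * m))\<^sup>2) \<longleftrightarrow> m * (norm (v - y))\<^sup>2 \<le> F v \<bullet> (v - y)"
        using m by (simp add: field_simps)
      finally show ?thesis by simp
    qed
    thus ?thesis by (simp add: set_eq_iff)
  qed
  have M: "closed (M v)" "convex (M v)" "bounded (M v)" for v
    unfolding M_def M_ball using C by (simp_all add: closed_Int convex_Int bounded_Int)
  have hull: "convex hull W \<subseteq> C" if "W \<subseteq> C" for W
    using that C by (simp add: hull_minimal)
  \<comment> \<open>With \<open>y\<close> a convex combination of \<open>W\<close>, the weighted sum
    of the numbers \<open>F y \<bullet> (x - y)\<close> vanishes, so one of them is nonnegative;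
    pseudomonotonicity puts \<open>y\<close> into the corresponding \<open>M v\<close>.\<close>
  have KKM: "convex hull W \<subseteq> (\<Union>v\<in>W. M v)" if W: "finite W" "W \<subseteq> C" for W
  proof
    fix y assume y: "y \<in> convex hull W"
    then obtain u where u: "\<And>x. x \<in> W \<Longrightarrow> 0 \<le> u x" "sum u W = 1" "(\<Sum>x\<in>W. u x *\<^sub>R x) = y"
      unfolding convex_hull_finite[OF W(1)] by auto
    have "(\<Sum>x\<in>W. u x * (F y \<bullet> (x - y))) = F y \<bullet> ((\<Sum>x\<in>W. u x *\<^sub>R x) - sum u W *\<^sub>R y)"
      by (simp add: inner_sum_right inner_diff_right sum_subtractf right_diff_distrib
          scaleR_left.sum sum_distrib_right)
    hence 0: "(\<Sum>x\<in>W. u x * (F y \<bullet> (x - y))) = 0"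
      using u by simp
    have "\<exists>v\<in>W. 0 \<le> F y \<bullet> (v - y)"
    proof (rule ccontr)
      assume "\<not> ?thesis"
      hence neg: "F y \<bullet> (v - y) < 0" if "v \<in> W" for v using that by auto
      obtain w where w: "w \<in> W" "u w \<noteq> 0"
        using u(2) by (metis sum.neutral zero_neq_one)
      have "(\<Sum>x\<in>W. u x * (F y \<bullet> (x - y))) < (\<Sum>x\<in>W. 0)"
        using W(1) w u(1)[of w] neg[of w]
        by (intro sum_strict_mono_ex1 ballI mult_nonneg_nonpos u(1) less_imp_le[OF neg] bexI[of _ w])
           (auto simp: mult_less_0_iff)
      thus False using 0 by simp
    qed
    then obtain v where "v \<in> W" "0 \<le> F y \<bullet> (v - y)" by blast
    hence "y \<in> M v"
      using F(1) W hull[OF W(2)] y unfolding strongly_pseudomonotone_on_def M_def by blast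
    thus "y \<in> (\<Union>v\<in>W. M v)" using \<open>v \<in> W\<close> by blast
  qed
  have "\<Inter>(M ` C) \<noteq> {}"
  proof -
    obtain v0 where v0: "v0 \<in> C" using C by auto
    show ?thesis
    proof (rule bounded_closed_convex_Inter_nonempty[of _ "M v0"])
      fix \<G> assume \<G>: "finite \<G>" "\<G> \<subseteq> M ` C" "\<G> \<noteq> {}"
      then obtain V where V: "V \<subseteq> C" "finite V" "\<G> = M ` V"
        by (meson finite_subset_image)
      have "convex hull V \<inter> (\<Inter>v\<in>V. M v) \<noteq> {}"
        using V \<G> M by (intro KKM_convex KKM) (auto intro: finite_subset)
      thus "\<Inter>\<G> \<noteq> {}" using V by auto
    qed (use v0 M in auto)
  qed
  then obtain y where y: "\<And>v. v \<in> C \<Longrightarrow> y \<in> M v" by auto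
  have yC: "y \<in> C" using C y by (auto simp: M_def)
  have "0 \<le> F y \<bullet> (w - y)" if w: "w \<in> C" for w
  proof -
    \<comment> \<open>Minty's device for the way back: test at a point of the segment from
      \<open>y\<close> to \<open>w\<close>, divide by \<open>s\<close>, and let \<open>s\<close>
      tend to 0 by continuity of \<open>F\<close>.\<close>
    define v where "v s = y + s *\<^sub>R (w - y)" for s :: real
    have vC: "v s \<in> C" if "s \<in> {0..1}" for s
    proof -
      have "v s = (1 - s) *\<^sub>R y + s *\<^sub>R w" by (simp add: v_def algebra_simps)
      thus ?thesis using convexD[OF C(2) yC w, of "1 - s" s] that by auto
    qed
    have "0 \<le> F (v s) \<bullet> (w - y)" if "0 < s" "s \<le> 1" for s
    proof -
      have "0 \<le> m * (norm (v s - y))\<^sup>2" using m by simp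
      also have "\<dots> \<le> F (v s) \<bullet> (v s - y)"
        using y[OF vC[of s]] that by (simp add: M_def)
      finally show ?thesis using that by (simp add: v_def zero_le_mult_iff)
    qed
    hence ev: "\<forall>\<^sub>F s in at 0 within {0..1}. 0 \<le> F (v s) \<bullet> (w - y)"
      by (auto simp: eventually_at intro!: exI[of _ 1])
    have "continuous_on {0..1} (\<lambda>s. F (v s) \<bullet> (w - y))"
    proof (intro continuous_intros)
      show "continuous_on {0..1} (\<lambda>s. F (v s))"
        by (rule continuous_on_compose2[OF F(2)]) (use vC in \<open>auto simp: v_def intro!: continuous_intros\<close>)
    qed
    hence "((\<lambda>s. F (v s) \<bullet> (w - y)) \<longlongrightarrow> F (v 0) \<bullet> (w - y)) (at 0 within {0..1})"
      by (auto simp: continuous_on_def)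
    moreover have "at (0::real) within {0..1} \<noteq> bot"
      by (simp add: at_within_Icc_at_right)
    ultimately have "0 \<le> F (v 0) \<bullet> (w - y)"
      using tendsto_lowerbound ev by blast
    thus ?thesis by (simp add: v_def)
  qed
  thus ?thesis using yC unfolding vi_solution_def by blast
qed

text \<open>The inequality for \<open>y\<close> is used in Minty form at \<open>z\<close>, the one
  for \<open>z\<close> is tested at \<open>y\<close>; together they leave only the discrepancy of
  the operators at \<open>z\<close>. Taking \<open>G = F\<close> gives uniqueness, operators at two
  states give Lipschitz dependence.\<close>

lemma vi_solution_dist_le:
  assumes F: "strongly_pseudomonotone_on C m F"
    and y: "vi_solution F C y" and z: "vi_solution G C z"
  shows "m * norm (z - y) \<le> norm (F z - G z)"
proof (cases "z = y")
  case False
  have "m * (norm (z - y))\<^sup>2 \<le> F z \<bullet> (z - y)"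
    using vi_solution_strong_ineq[OF F y, of z] z by (simp add: vi_solution_def)
  also have "\<dots> \<le> (F z - G z) \<bullet> (z - y)"
  proof -
    have "0 \<le> G z \<bullet> (y - z)"
      using y z unfolding vi_solution_def by blast
    thus ?thesis by (simp add: inner_diff)
  qed
  also have "\<dots> \<le> norm (F z - G z) * norm (z - y)"
    by (rule norm_cauchy_schwarz)
  finally show ?thesis using False by (simp add: power2_eq_square mult_le_cancel_right)
qed simp

lemma vi_solution_unique:
  assumes F: "strongly_pseudomonotone_on C m F"
    and "vi_solution F C y" "vi_solution F C z"
  shows "y = z"
  using vi_solution_dist_le[OF assms] F by (simp add: strongly_pseudomonotone_on_def mult_le_0_iff)

section \<open>The frozen problem\<close>

lemma coercive_norm_le:
  assumes "c * (norm x)\<^sup>2 \<le> P x \<bullet> x"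
  shows "c * norm x \<le> norm (P x)"
proof (cases "x = 0")
  case False
  have "c * (norm x)\<^sup>2 \<le> norm (P x) * norm x"
    using assms norm_cauchy_schwarz[of "P x" x] by linarith
  thus ?thesis using False by (simp add: power2_eq_square mult.assoc[symmetric])
qed simp

text \<open>
  Surjectivity follows from the contraction principle for \<open>x \<mapsto> x - \<rho> (P x - y)\<close> with \<open>\<rho> = c / M\<^sup>2\<close>,
  where \<open>c\<close> is the coercivity constant and \<open>M \<ge> \<parallel>P\<parallel>\<close>.
\<close>

lemma bij_coercive:
  fixes P :: "'a::{real_inner, banach} \<Rightarrow> 'a"
  assumes "bounded_linear P" "coercive P"
  shows "bij P"
proof -
  interpret bounded_linear P by fact
  obtain c where c: "0 < c" "\<And>x. c * (norm x)\<^sup>2 \<le> P x \<bullet> x"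
    using assms(2) unfolding coercive_def by blast
  obtain N where N: "0 < N" "\<And>x. norm (P x) \<le> norm x * N"
    using pos_bounded by blast
  \<comment> \<open>Adding \<open>c\<close> to the norm bound forces \<open>c < M\<close>, so that
    \<open>q\<close> below is strictly positive.\<close>
  define M where "M = N + c"
  have M: "c < M" "norm (P x) \<le> M * norm x" for x
    using N(1) order_trans[OF N(2)[of x], of "M * norm x"] c(1)
    by (auto simp: M_def algebra_simps)
  \<comment> \<open>This value minimizes \<open>1 - 2 * \<rho> * c + (\<rho> * M)\<^sup>2\<close>,
    and \<open>q\<close> is the minimum; the contraction factor is \<open>sqrt q\<close>.\<close>
  define \<rho> where "\<rho> = c / M\<^sup>2"
  define q where "q = 1 - c\<^sup>2 / M\<^sup>2"
  have "c\<^sup>2 < M\<^sup>2" using M(1) c(1) by (intro power_strict_mono) auto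
  hence q: "0 < q" "q < 1" using c(1) M(1) by (auto simp: q_def)
  have contr: "(norm (w - \<rho> *\<^sub>R P w))\<^sup>2 \<le> q * (norm w)\<^sup>2" for w
  proof -
    have "0 < \<rho>" using c M by (simp add: \<rho>_def)
    have "(norm (P w))\<^sup>2 \<le> (M * norm w)\<^sup>2"
      using M(2)[of w] by (intro power_mono) auto
    hence "\<rho>\<^sup>2 * (norm (P w))\<^sup>2 \<le> \<rho>\<^sup>2 * (M * norm w)\<^sup>2"
      by (intro mult_left_mono) auto
    moreover have "2 * \<rho> * (c * (norm w)\<^sup>2) \<le> 2 * \<rho> * (P w \<bullet> w)"
      using c(2)[of w] \<open>0 < \<rho>\<close> by (intro mult_left_mono) auto
    moreover have "(norm (w - \<rho> *\<^sub>R P w))\<^sup>2 =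
        (norm w)\<^sup>2 - 2 * \<rho> * (P w \<bullet> w) + \<rho>\<^sup>2 * (norm (P w))\<^sup>2"
      unfolding power2_norm_eq_inner
      by (simp add: inner_diff inner_commute power2_eq_square algebra_simps)
    moreover have "q * (norm w)\<^sup>2 =
        (norm w)\<^sup>2 - 2 * \<rho> * (c * (norm w)\<^sup>2) + \<rho>\<^sup>2 * (M * norm w)\<^sup>2"
      using M(1) c(1) by (simp add: q_def \<rho>_def power_mult_distrib power2_eq_square field_simps)
    ultimately show ?thesis by linarith
  qed
  have "\<exists>x. P x = y" for y
  proof -
    define \<phi> where "\<phi> x = x - \<rho> *\<^sub>R (P x - y)" for x
    have "dist (\<phi> v) (\<phi> w) \<le> sqrt q * dist v w" for v w
    proof -
      have "\<phi> v - \<phi> w = (v - w) - \<rho> *\<^sub>R P (v - w)"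
        by (simp add: \<phi>_def diff algebra_simps)
      hence "(norm (\<phi> v - \<phi> w))\<^sup>2 \<le> q * (norm (v - w))\<^sup>2"
        using contr[of "v - w"] by simp
      hence "sqrt ((norm (\<phi> v - \<phi> w))\<^sup>2) \<le> sqrt (q * (norm (v - w))\<^sup>2)"
        by (rule real_sqrt_le_mono)
      thus ?thesis by (simp add: real_sqrt_mult dist_norm)
    qed
    hence "\<exists>!x. \<phi> x = x"
      using q by (intro banach_fix_type[of "sqrt q"]) auto
    then obtain x where "\<phi> x = x" by blast
    hence "\<rho> *\<^sub>R (P x - y) = 0" by (simp add: \<phi>_def)
    moreover have "\<rho> \<noteq> 0" using c M(1) by (auto simp: \<rho>_def)
    ultimately show ?thesis by auto
  qed
  hence "surj P" by (metis surjI)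
  moreover have "inj P"
  proof (rule injI)
    fix v w assume "P v = P w"
    hence "c * norm (v - w) \<le> 0"
      using coercive_norm_le[of c "v - w" P, OF c(2)] by (simp add: diff)
    thus "v = w" using c(1) by (simp add: mult_le_0_iff)
  qed
  ultimately show ?thesis by (simp add: bij_def)
qed

text \<open>The limit at 0 is one-sided and excludes 0, whereas \<open>\<tau> n = t\<close> may
  occur; continuity on the closed half-line gives the missing value
  \<open>\<omega> 0 = 0\<close>.\<close>

lemma modulus_tendsto:
  assumes \<omega>: "modulus \<omega>" and \<tau>: "\<tau> \<longlonglongrightarrow> t"
  shows "(\<lambda>n. \<omega> \<bar>\<tau> n - t\<bar>) \<longlonglongrightarrow> 0"
proof -
  have cont: "continuous_on {0..} \<omega>" and lim: "(\<omega> \<longlongrightarrow> 0) (at_right 0)"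
    using \<omega> by (auto simp: modulus_def)
  have "(\<omega> \<longlongrightarrow> \<omega> 0) (at_right 0)"
    using cont by (auto simp: continuous_on_def at_within_Ici_at_right dest!: bspec[of _ _ 0])
  hence "\<omega> 0 = 0"
    using lim tendsto_unique trivial_limit_at_right_real by blast
  moreover have "(\<lambda>n. \<bar>\<tau> n - t\<bar>) \<longlonglongrightarrow> 0"
    using \<tau> by (simp add: LIM_zero tendsto_rabs_zero)
  hence "(\<lambda>n. \<omega> \<bar>\<tau> n - t\<bar>) \<longlonglongrightarrow> \<omega> 0"
    by (intro continuous_on_tendsto_compose[OF cont]) auto
  ultimately show ?thesis by simp
qed

lemma frozen_solution_iff_vi_solution:
  assumes "inj P"
  shows "frozen_solution P K h t x u \<longleftrightarrow> vi_solution (vi_operator P h t x) (K t) (P u)"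
  using assms by (simp add: frozen_solution_def vi_solution_def vi_operator_def inner_diff_left)

locale frozen_problem =
  fixes T \<gamma> L\<^sub>F \<alpha>\<^sub>h :: real
    and P :: "'a::{real_inner, banach, second_countable_topology} \<Rightarrow> 'a"
    and K :: "real \<Rightarrow> 'a set"
    and h :: "real \<Rightarrow> 'a \<Rightarrow> 'a \<Rightarrow> 'a"
  assumes P: "bounded_linear P" "coercive P"
    and K: "t \<in> {0..T} \<Longrightarrow> K t \<noteq> {}" "t \<in> {0..T} \<Longrightarrow> closed (K t)"
      "t \<in> {0..T} \<Longrightarrow> convex (K t)"
    and pseudomonotone: "t \<in> {0..T} \<Longrightarrow> strongly_pseudomonotone_on (K t) \<gamma> (vi_operator P h t x)"
    and lipschitz: "t \<in> {0..T} \<Longrightarrow> L\<^sub>F-lipschitz_on UNIV (vi_operator P h t x)"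
    and \<gamma>: "0 < \<gamma>"
    and h_lip: "t \<in> {0..T} \<Longrightarrow> norm (h t x1 u - h t x2 u) \<le> \<alpha>\<^sub>h * norm (x1 - x2)"
    and K_time: "time_regular_sets T K"
    and h_time: "time_regular_map T h"
begin

lemma bij_P: "bij P"
  using P by (rule bij_coercive)

lemma frozen_solution_iff:
  "frozen_solution P K h t x u \<longleftrightarrow> vi_solution (vi_operator P h t x) (K t) (P u)"
  using bij_P by (intro frozen_solution_iff_vi_solution bij_is_inj)

lemma frozen_solution_ex1:
  assumes t: "t \<in> {0..T}"
  shows "\<exists>!u. frozen_solution P K h t x u"
proof -
  have "\<exists>y. vi_solution (vi_operator P h t x) (K t) y"
    using K[OF t] pseudomonotone[OF t]
      continuous_on_subset[OF lipschitz_on_continuous_on[OF lipschitz[OF t]] subset_UNIV]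
    by (intro vi_solution_exists[where m = \<gamma>]) auto
  hence "\<exists>u. frozen_solution P K h t x u"
    unfolding frozen_solution_iff using bij_P by (metis bij_is_surj surjD)
  moreover have "u = w" if "frozen_solution P K h t x u" "frozen_solution P K h t x w" for u w
    using that vi_solution_unique[OF pseudomonotone[OF t]] bij_is_inj[OF bij_P]
    unfolding frozen_solution_iff by (meson injD)
  ultimately show ?thesis by blast
qed

lemma frozen_solution_frozen_value:
  "t \<in> {0..T} \<Longrightarrow> frozen_solution P K h t x (frozen_value P K h t x)"
  unfolding frozen_value_def by (rule theI'[OF frozen_solution_ex1])

lemma frozen_value_eq:
  "t \<in> {0..T} \<Longrightarrow> frozen_solution P K h t x u \<Longrightarrow> frozen_value P K h t x = u"
  using frozen_solution_ex1 frozen_solution_frozen_value by blast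

lemma frozen_value_vi_solution:
  "t \<in> {0..T} \<Longrightarrow> vi_solution (vi_operator P h t x) (K t) (P (frozen_value P K h t x))"
  using frozen_solution_frozen_value frozen_solution_iff by blast

lemma vi_operator_P: "vi_operator P h t x (P u) = u - h t x u"
  using bij_P by (simp add: vi_operator_def bij_is_inj)

text \<open>The variational inequality controls \<open>P u\<close>; this bound carries its estimates
  back to \<open>u\<close>.\<close>

lemma norm_le_norm_P: "\<exists>c>0. \<forall>u w. norm (u - w) \<le> c * norm (P u - P w)"
proof -
  interpret bounded_linear P by (rule P)
  obtain c where c: "0 < c" "\<And>x. c * (norm x)\<^sup>2 \<le> P x \<bullet> x"
    using P(2) unfolding coercive_def by blast
  have "norm (u - w) \<le> (1 / c) * norm (P u - P w)" for u w
    using coercive_norm_le[of c "u - w" P, OF c(2)] c(1) by (simp add: field_simps diff)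
  thus ?thesis using c(1) by (intro exI[of _ "1 / c"]) auto
qed

text \<open>At a fixed time both inequalities share the set \<open>K t\<close>, and at
  \<open>P u1\<close> the two operators differ by \<open>h t x1 u1 - h t x2 u1\<close>, a change of
  state alone. The resulting constant does not involve \<open>t\<close>.\<close>

lemma frozen_value_lipschitz:
  "\<exists>C\<ge>0. \<forall>t\<in>{0..T}. \<forall>x1 x2.
     norm (frozen_value P K h t x1 - frozen_value P K h t x2) \<le> C * norm (x1 - x2)"
proof -
  obtain c where c: "0 < c" "\<And>u w. norm (u - w) \<le> c * norm (P u - P w)"
    using norm_le_norm_P by blast
  have "norm (frozen_value P K h t x1 - frozen_value P K h t x2) \<le> (c * (\<bar>\<alpha>\<^sub>h\<bar> / \<gamma>)) * norm (x1 - x2)"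
    if t: "t \<in> {0..T}" for t x1 x2
  proof -
    define u1 u2 where "u1 = frozen_value P K h t x1" and "u2 = frozen_value P K h t x2"
    have "\<gamma> * norm (P u1 - P u2) \<le> norm (vi_operator P h t x2 (P u1) - vi_operator P h t x1 (P u1))"
      unfolding u1_def u2_def
      by (rule vi_solution_dist_le[OF pseudomonotone[OF t] frozen_value_vi_solution[OF t]
            frozen_value_vi_solution[OF t]])
    also have "\<dots> = norm (h t x1 u1 - h t x2 u1)"
      by (simp add: vi_operator_P)
    also have "\<dots> \<le> \<alpha>\<^sub>h * norm (x1 - x2)" by (rule h_lip[OF t])
    \<comment> \<open>The locale fixes no sign for \<open>\<alpha>\<^sub>h\<close>; the absolute
      value keeps the final constant nonnegative.\<close>
    also have "\<dots> \<le> \<bar>\<alpha>\<^sub>h\<bar> * norm (x1 - x2)" by (intro mult_right_mono) auto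
    finally have "norm (P u1 - P u2) \<le> \<bar>\<alpha>\<^sub>h\<bar> / \<gamma> * norm (x1 - x2)"
      using \<gamma> by (simp add: field_simps)
    hence "c * norm (P u1 - P u2) \<le> c * (\<bar>\<alpha>\<^sub>h\<bar> / \<gamma> * norm (x1 - x2))"
      using c(1) by (intro mult_left_mono) auto
    thus ?thesis using c(2)[of u1 u2] by (simp add: u1_def u2_def mult.assoc)
  qed
  moreover have "0 \<le> c * (\<bar>\<alpha>\<^sub>h\<bar> / \<gamma>)" using c(1) \<gamma> by simp
  ultimately show ?thesis by blast
qed

text \<open>
  Each solution is tested against the projection of the other one onto its own constraint set; the
  projections stay close to the solutions by the time regularity of \<open>K\<close>.
\<close>

lemma P_frozen_value_tendsto:
  assumes \<tau>: "\<And>n. \<tau> n \<in> {0..T}" and t: "t \<in> {0..T}" and lim: "\<tau> \<longlonglongrightarrow> t"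
  shows "(\<lambda>n. P (frozen_value P K h (\<tau> n) x)) \<longlonglongrightarrow> P (frozen_value P K h t x)"
proof -
  define u where "u = frozen_value P K h t x"
  define y where "y = P u"
  define Y where "Y n = P (frozen_value P K h (\<tau> n) x)" for n
  define F where "F n = vi_operator P h (\<tau> n) x" for n
  \<comment> \<open>\<open>p n\<close> is admissible at time \<open>\<tau> n\<close> and close to
    \<open>y\<close>; \<open>q n\<close> is admissible at time \<open>t\<close> and close to
    \<open>Y n\<close>.\<close>
  define p where "p n = metric_proj (K (\<tau> n)) y" for n
  define q where "q n = metric_proj (K t) (Y n)" for n
  define w where "w = vi_operator P h t x y"
  have y: "y \<in> K t" "\<And>v. v \<in> K t \<Longrightarrow> 0 \<le> w \<bullet> (v - y)"
    using frozen_value_vi_solution[OF t, of x]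
    by (auto simp: vi_solution_def y_def u_def w_def)
  have Y: "vi_solution (F n) (K (\<tau> n)) (Y n)" for n
    unfolding F_def Y_def by (rule frozen_value_vi_solution[OF \<tau>])
  have YK: "Y n \<in> K (\<tau> n)" for n
    using Y by (simp add: vi_solution_def)
  have pK: "p n \<in> K (\<tau> n)" for n
    unfolding p_def using K \<tau> by (intro metric_proj_mem) auto
  have qK: "q n \<in> K t" for n
    unfolding q_def using K t by (intro metric_proj_mem) auto
  have y_self: "metric_proj (K t) y = y"
    using K t y by (intro metric_proj_self) auto
  have Y_self: "metric_proj (K (\<tau> n)) (Y n) = Y n" for n
    using K \<tau>[of n] YK by (intro metric_proj_self) auto
  have p_lim: "(\<lambda>n. p n - y) \<longlonglongrightarrow> 0"
  proof -
    obtain \<omega> where \<omega>: "modulus \<omega>" and le: "\<And>t1 t2 z. t1 \<in> {0..T} \<Longrightarrow> t2 \<in> {0..T} \<Longrightarrow>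
        norm z \<le> norm y \<Longrightarrow> norm (metric_proj (K t1) z - metric_proj (K t2) z) \<le> \<omega> \<bar>t1 - t2\<bar>"
      using K_time[unfolded time_regular_sets_def, rule_format, of "norm y"] by auto
    have "norm (p n - y) \<le> \<omega> \<bar>\<tau> n - t\<bar>" for n
      using le[OF \<tau>[of n] t, of y] by (simp add: p_def y_self)
    thus ?thesis
      by (intro Lim_null_comparison[OF _ modulus_tendsto[OF \<omega> lim]] always_eventually) auto
  qed
  have w_lim: "(\<lambda>n. F n (p n) - w) \<longlonglongrightarrow> 0"
  proof -
    obtain \<omega> where \<omega>: "modulus \<omega>" and le: "\<And>t1 t2 a b. t1 \<in> {0..T} \<Longrightarrow> t2 \<in> {0..T} \<Longrightarrow>
        norm a \<le> norm x + norm u \<Longrightarrow> norm b \<le> norm x + norm u \<Longrightarrow>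
        norm (h t1 a b - h t2 a b) \<le> \<omega> \<bar>t1 - t2\<bar>"
      using h_time[unfolded time_regular_map_def, rule_format, of "norm x + norm u"] by auto
    have "norm (F n (p n) - w) \<le> L\<^sub>F * norm (p n - y) + \<omega> \<bar>\<tau> n - t\<bar>" for n
    proof -
      have "norm (F n (p n) - F n y) \<le> L\<^sub>F * norm (p n - y)"
        using lipschitz_onD[OF lipschitz[OF \<tau>[of n]], of "p n" y x] by (simp add: F_def dist_norm)
      moreover have "norm (F n y - w) \<le> \<omega> \<bar>\<tau> n - t\<bar>"
        using le[OF \<tau>[of n] t, of x u]
        by (simp add: F_def w_def y_def vi_operator_P norm_minus_commute)
      moreover have "norm (F n (p n) - w) \<le> norm (F n (p n) - F n y) + norm (F n y - w)"
        using norm_triangle_ineq[of "F n (p n) - F n y" "F n y - w"] by simp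
      ultimately show ?thesis by linarith
    qed
    moreover have "(\<lambda>n. L\<^sub>F * norm (p n - y) + \<omega> \<bar>\<tau> n - t\<bar>) \<longlonglongrightarrow> 0"
      using tendsto_add[OF tendsto_mult_right_zero[OF tendsto_norm_zero[OF p_lim]]
          modulus_tendsto[OF \<omega> lim]] by simp
    ultimately show ?thesis
      by (rule Lim_null_comparison[OF always_eventually[OF allI]])
  qed
  have strong: "\<gamma> * (norm (p n - Y n))\<^sup>2 \<le> F n (p n) \<bullet> (p n - Y n)" for n
    using vi_solution_strong_ineq[OF pseudomonotone[OF \<tau>[of n]] Y[of n, unfolded F_def] pK[of n]]
    by (simp add: F_def)
  obtain Bw where Bw: "\<And>n. norm (F n (p n) - w) \<le> Bw"
    using convergent_imp_Bseq[OF convergentI[OF w_lim], unfolded Bseq_def] by blast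
  obtain Bp where Bp: "\<And>n. norm (p n - y) \<le> Bp"
    using convergent_imp_Bseq[OF convergentI[OF p_lim], unfolded Bseq_def] by blast
  \<comment> \<open>Cauchy-Schwarz in the strong inequality, divided by
    \<open>norm (p n - Y n)\<close>, bounds this norm by
    \<open>norm (F n (p n)) / \<gamma>\<close>.\<close>
  define B where "B = (norm w + Bw) / \<gamma>"
  have pY: "norm (p n - Y n) \<le> B" for n
  proof (cases "p n = Y n")
    case True
    have "0 \<le> Bw" using Bw[of n] norm_ge_zero order_trans by blast
    thus ?thesis using True \<gamma> by (simp add: B_def)
  next
    case False
    have "\<gamma> * (norm (p n - Y n))\<^sup>2 \<le> norm (F n (p n)) * norm (p n - Y n)"
      using strong[of n] norm_cauchy_schwarz order_trans by blast
    hence "\<gamma> * norm (p n - Y n) \<le> norm (F n (p n))"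
      using False by (simp add: power2_eq_square mult.assoc[symmetric])
    also have "\<dots> \<le> norm w + Bw"
      using Bw[of n] norm_triangle_ineq[of "F n (p n) - w" w] by simp
    finally show ?thesis using \<gamma> by (simp add: B_def field_simps)
  qed
  \<comment> \<open>The modulus of \<open>K\<close> depends on a radius, so a bound on all
    \<open>Y n\<close> has to precede the estimate of \<open>q n - Y n\<close>.\<close>
  define R where "R = B + Bp + norm y"
  have Y_R: "norm (Y n) \<le> R" for n
  proof -
    have "Y n = (p n - y) - (p n - Y n) + y" by simp
    hence "norm (Y n) \<le> norm (p n - y) + norm (p n - Y n) + norm y"
      by (metis add_mono_thms_linordered_semiring(3) norm_triangle_ineq norm_triangle_ineq4 order_trans)
    thus ?thesis using pY[of n] Bp[of n] by (simp add: R_def)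
  qed
  have "0 \<le> R" using Y_R[of 0] norm_ge_zero order_trans by blast
  then obtain \<omega> where \<omega>: "modulus \<omega>" and le: "\<And>t1 t2 z. t1 \<in> {0..T} \<Longrightarrow> t2 \<in> {0..T} \<Longrightarrow>
      norm z \<le> R \<Longrightarrow> norm (metric_proj (K t1) z - metric_proj (K t2) z) \<le> \<omega> \<bar>t1 - t2\<bar>"
    using K_time[unfolded time_regular_sets_def, rule_format, of R] by auto
  have q_le: "norm (q n - Y n) \<le> \<omega> \<bar>\<tau> n - t\<bar>" for n
    using le[OF t \<tau>[of n] Y_R[of n]] by (simp add: q_def Y_self abs_minus_commute)
  have main: "(norm (p n - Y n))\<^sup>2 \<le>
      (norm (F n (p n) - w) * B + norm w * norm (p n - y) + norm w * \<omega> \<bar>\<tau> n - t\<bar>) / \<gamma>" for n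
  proof -
    \<comment> \<open>In this splitting \<open>w \<bullet> (q n - y)\<close> is nonnegative by the
      inequality for \<open>y\<close> and enters with a minus sign; the other three terms tend to
      0.\<close>
    have "F n (p n) \<bullet> (p n - Y n) =
        (F n (p n) - w) \<bullet> (p n - Y n) + w \<bullet> (p n - y) - w \<bullet> (q n - y) + w \<bullet> (q n - Y n)"
      by (simp add: inner_diff)
    moreover have "(F n (p n) - w) \<bullet> (p n - Y n) \<le> norm (F n (p n) - w) * B"
      using norm_cauchy_schwarz order_trans mult_left_mono[OF pY[of n] norm_ge_zero] by blast
    moreover have "w \<bullet> (p n - y) \<le> norm w * norm (p n - y)"
      by (rule norm_cauchy_schwarz)
    moreover have "w \<bullet> (q n - Y n) \<le> norm w * \<omega> \<bar>\<tau> n - t\<bar>"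
      using norm_cauchy_schwarz order_trans mult_left_mono[OF q_le[of n] norm_ge_zero] by blast
    moreover have "0 \<le> w \<bullet> (q n - y)" by (rule y(2)[OF qK])
    ultimately have "\<gamma> * (norm (p n - Y n))\<^sup>2 \<le>
        norm (F n (p n) - w) * B + norm w * norm (p n - y) + norm w * \<omega> \<bar>\<tau> n - t\<bar>"
      using strong[of n] by linarith
    thus ?thesis using \<gamma> by (simp add: field_simps)
  qed
  have "(\<lambda>n. (norm (F n (p n) - w) * B + norm w * norm (p n - y) + norm w * \<omega> \<bar>\<tau> n - t\<bar>) / \<gamma>)
      \<longlonglongrightarrow> (0 * B + norm w * 0 + norm w * 0) / \<gamma>"
    using \<gamma> by (intro tendsto_intros tendsto_norm_zero w_lim p_lim modulus_tendsto[OF \<omega> lim]) auto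
  hence "(\<lambda>n. (norm (F n (p n) - w) * B + norm w * norm (p n - y) + norm w * \<omega> \<bar>\<tau> n - t\<bar>) / \<gamma>)
      \<longlonglongrightarrow> 0"
    by simp
  moreover have "norm ((norm (p n - Y n))\<^sup>2) \<le>
      (norm (F n (p n) - w) * B + norm w * norm (p n - y) + norm w * \<omega> \<bar>\<tau> n - t\<bar>) / \<gamma>" for n
    using main[of n] by simp
  ultimately have "(\<lambda>n. (norm (p n - Y n))\<^sup>2) \<longlonglongrightarrow> 0"
    by (rule Lim_null_comparison[OF always_eventually[OF allI], rotated])
  hence "(\<lambda>n. p n - Y n) \<longlonglongrightarrow> 0"
    by (simp add: tendsto_norm_zero_iff)
  hence "(\<lambda>n. (p n - y) - (p n - Y n) + y) \<longlonglongrightarrow> 0 - 0 + y"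
    by (intro tendsto_intros p_lim)
  thus ?thesis by (simp add: Y_def y_def u_def)
qed

text \<open>The Lipschitz constant is uniform in time, so \<open>x (\<tau> n)\<close> may be
  replaced by \<open>x t\<close> at vanishing cost, which leaves convergence in time at a fixed
  state.\<close>

lemma continuous_on_frozen_value:
  assumes x: "continuous_on {0..T} x"
  shows "continuous_on {0..T} (\<lambda>t. frozen_value P K h t (x t))"
proof -
  obtain C where C: "\<And>t x1 x2. t \<in> {0..T} \<Longrightarrow>
      norm (frozen_value P K h t x1 - frozen_value P K h t x2) \<le> C * norm (x1 - x2)"
    using frozen_value_lipschitz by blast
  obtain c where c: "\<And>u w. norm (u - w) \<le> c * norm (P u - P w)"
    using norm_le_norm_P by blast
  have "(\<lambda>n. frozen_value P K h (\<tau> n) (x (\<tau> n))) \<longlonglongrightarrow> frozen_value P K h t (x t)"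
    if \<tau>: "\<And>n. \<tau> n \<in> {0..T}" and t: "t \<in> {0..T}" and lim: "\<tau> \<longlonglongrightarrow> t" for \<tau> t
  proof -
    let ?u = "\<lambda>s z. frozen_value P K h s z"
    have le: "norm (?u (\<tau> n) (x (\<tau> n)) - ?u t (x t)) \<le>
        C * norm (x (\<tau> n) - x t) + c * norm (P (?u (\<tau> n) (x t)) - P (?u t (x t)))" for n
      using C[OF \<tau>[of n], of "x (\<tau> n)" "x t"] c[of "?u (\<tau> n) (x t)" "?u t (x t)"]
        norm_triangle_ineq[of "?u (\<tau> n) (x (\<tau> n)) - ?u (\<tau> n) (x t)" "?u (\<tau> n) (x t) - ?u t (x t)"]
      by simp
    have "(\<lambda>n. x (\<tau> n)) \<longlonglongrightarrow> x t"
      using continuous_on_tendsto_compose[OF x lim t] \<tau> by simp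
    hence "(\<lambda>n. C * norm (x (\<tau> n) - x t) + c * norm (P (?u (\<tau> n) (x t)) - P (?u t (x t))))
        \<longlonglongrightarrow> C * 0 + c * 0"
      using P_frozen_value_tendsto[OF \<tau> t lim]
      by (intro tendsto_intros tendsto_norm_zero) (simp_all add: LIM_zero)
    hence lim0: "(\<lambda>n. C * norm (x (\<tau> n) - x t) + c * norm (P (?u (\<tau> n) (x t)) - P (?u t (x t))))
        \<longlonglongrightarrow> 0"
      by simp
    have "(\<lambda>n. ?u (\<tau> n) (x (\<tau> n)) - ?u t (x t)) \<longlonglongrightarrow> 0"
      by (rule Lim_null_comparison[OF always_eventually[OF allI[OF le]] lim0])
    thus ?thesis by (rule LIM_zero_cancel)
  qed
  thus ?thesis unfolding continuous_on_sequentially comp_def by blast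
qed

end

section \<open>Strongly continuous semigroups\<close>

text \<open>Baire category: the closed sets of uniform bound \<open>n\<close> cover the space, so
  one of them contains a ball.\<close>

lemma uniform_boundedness_principle:
  fixes B :: "'i \<Rightarrow> 'a::banach \<Rightarrow> 'b::real_normed_vector"
  assumes lin: "\<And>i. i \<in> I \<Longrightarrow> bounded_linear (B i)"
    and bdd: "\<And>x. bounded ((\<lambda>i. B i x) ` I)"
  shows "\<exists>M\<ge>0. \<forall>i\<in>I. \<forall>x. norm (B i x) \<le> M * norm x"
proof -
  define F where "F n = {x. \<forall>i\<in>I. norm (B i x) \<le> real n}" for n :: nat
  have closed_F: "closed (F n)" for n
  proof -
    have "F n = (\<Inter>i\<in>I. {x. norm (B i x) \<le> real n})" by (auto simp: F_def)
    moreover have "closed {x. norm (B i x) \<le> real n}" if "i \<in> I" for i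
      using linear_continuous_on[OF lin[OF that], of UNIV]
      by (intro closed_Collect_le continuous_intros)
    ultimately show ?thesis by (simp add: closed_INT)
  qed
  have "\<exists>n. x \<in> F n" for x
  proof -
    obtain b where "\<And>i. i \<in> I \<Longrightarrow> norm (B i x) \<le> b"
      using bdd[of x] by (auto simp: bounded_iff)
    moreover obtain n :: nat where "b \<le> n" using real_arch_simple by blast
    ultimately show ?thesis unfolding F_def using order_trans by blast
  qed
  hence "\<Union>(range F) = UNIV" by auto
  hence "euclidean interior_of \<Union>(range F) \<noteq> ({} :: 'a set)" by simp
  then obtain n where "interior (F n) \<noteq> {}"
    using Baire_category_alt[of "euclidean :: 'a topology" "range F"] closed_F
      completely_metrizable_space_euclidean
    by force
  then obtain x e where e: "0 < e" "cball x e \<subseteq> F n"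
    by (meson all_not_in_conv mem_interior_cball)
  have "norm (B i z) \<le> (2 * real n / e) * norm z" if i: "i \<in> I" for i z
  proof (cases "z = 0")
    case True
    interpret bounded_linear "B i" by (rule lin[OF i])
    show ?thesis using True by (simp add: zero)
  next
    case False
    interpret bounded_linear "B i" by (rule lin[OF i])
    \<comment> \<open>\<open>x\<close> and \<open>y\<close> lie in the ball and differ by a multiple
      of \<open>z\<close> of length \<open>e\<close>; subtracting their bounds gives the constant
      \<open>2 * real n / e\<close>.\<close>
    define y where "y = x + (e / norm z) *\<^sub>R z"
    have "x \<in> F n" "y \<in> F n"
      using e False by (auto simp: y_def dist_norm intro!: subsetD[OF e(2)])
    hence "norm (B i y - B i x) \<le> 2 * real n"
      using norm_triangle_ineq4[of "B i y" "B i x"] i by (fastforce simp: F_def)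
    moreover have "B i y - B i x = (e / norm z) *\<^sub>R B i z"
      by (simp add: y_def add scaleR)
    ultimately show ?thesis
      using e False by (simp add: field_simps)
  qed
  thus ?thesis using e by (intro exI[of _ "2 * real n / e"]) auto
qed

lemma c0_semigroupD:
  assumes "c0_semigroup S"
  shows c0_semigroup_bounded_linear: "0 \<le> t \<Longrightarrow> bounded_linear (S t)"
    and c0_semigroup_0: "S 0 x = x"
    and c0_semigroup_add: "0 \<le> s \<Longrightarrow> 0 \<le> t \<Longrightarrow> S (s + t) x = S s (S t x)"
    and c0_semigroup_tendsto: "((\<lambda>t. S t x) \<longlongrightarrow> x) (at_right 0)"
  using assms unfolding c0_semigroup_def by auto

text \<open>Otherwise operators with unbounded norms occur at times \<open>t n\<close> tending to 0;
  every orbit converges along these times, so uniform boundedness is contradicted.\<close>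

lemma c0_semigroup_bounded_near_0:
  fixes S :: "real \<Rightarrow> 'a::banach \<Rightarrow> 'a"
  assumes S: "c0_semigroup S"
  shows "\<exists>\<delta>>0. \<exists>M\<ge>0. \<forall>t\<in>{0..\<delta>}. \<forall>x. norm (S t x) \<le> M * norm x"
proof (rule ccontr)
  assume neg: "\<not> ?thesis"
  have "\<exists>t\<in>{0..1 / Suc n}. \<exists>x. \<not> norm (S t x) \<le> real n * norm x" for n
  proof -
    have "0 < 1 / real (Suc n)" "0 \<le> real n" by auto
    thus ?thesis using neg by blast
  qed
  then obtain t x where t: "\<And>n. t n \<in> {0..1 / Suc n}"
    and x: "\<And>n. \<not> norm (S (t n) (x n)) \<le> real n * norm (x n)"
    by metis
  have t0: "t \<longlonglongrightarrow> 0"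
  proof (rule tendsto_sandwich[OF _ _ tendsto_const])
    show "(\<lambda>n. 1 / Suc n) \<longlonglongrightarrow> 0"
      using LIMSEQ_inverse_real_of_nat by (simp add: inverse_eq_divide)
  qed (use t in auto)
  have "bounded (range (\<lambda>n. S (t n) y))" for y
  proof -
    have "((\<lambda>t. S t y) \<longlongrightarrow> S 0 y) (at 0 within {0..1})"
      using c0_semigroup_tendsto[OF S, of y]
      by (simp add: c0_semigroup_0[OF S] at_within_Icc_at_right)
    moreover have "t n \<in> {0..1}" for n
      using order_trans[of "t n" "1 / Suc n" 1] t[of n] by simp
    ultimately have "(\<lambda>n. S (t n) y) \<longlonglongrightarrow> S 0 y"
      using continuous_within_tendsto_compose[of 0 "{0..1}" "\<lambda>t. S t y" t sequentially] t0
      by (auto simp: continuous_within)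
    thus ?thesis by (rule convergent_imp_bounded)
  qed
  hence "\<exists>M\<ge>0. \<forall>n\<in>UNIV. \<forall>y. norm (S (t n) y) \<le> M * norm y"
    using t c0_semigroup_bounded_linear[OF S] by (intro uniform_boundedness_principle) auto
  then obtain M where M: "\<And>n y. norm (S (t n) y) \<le> M * norm y" by blast
  obtain n :: nat where "M \<le> n" using real_arch_simple by blast
  hence "M * norm (x n) \<le> n * norm (x n)" by (intro mult_right_mono) auto
  thus False using x[of n] M[of n "x n"] by linarith
qed

lemma c0_semigroup_bounded_on:
  fixes S :: "real \<Rightarrow> 'a::banach \<Rightarrow> 'a"
  assumes S: "c0_semigroup S"
  shows "\<exists>M\<ge>0. \<forall>t\<in>{0..T}. \<forall>x. norm (S t x) \<le> M * norm x"
proof -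
  obtain \<delta> M where \<delta>: "0 < \<delta>" "0 \<le> M" "\<And>t x. t \<in> {0..\<delta>} \<Longrightarrow> norm (S t x) \<le> M * norm x"
    using c0_semigroup_bounded_near_0[OF S] by blast
  have "\<exists>C\<ge>0. \<forall>t\<in>{0..real n * \<delta>}. \<forall>x. norm (S t x) \<le> C * norm x" for n
  proof (induction n)
    case 0
    show ?case using c0_semigroup_0[OF S] by (intro exI[of _ 1]) auto
  next
    case (Suc n)
    then obtain C where C: "0 \<le> C" "\<And>t x. t \<in> {0..real n * \<delta>} \<Longrightarrow> norm (S t x) \<le> C * norm x"
      by blast
    \<comment> \<open>The sum dominates both \<open>C\<close>, for times already covered, and
      \<open>M * C\<close>, for one further step of length at most \<open>\<delta>\<close>.\<close>
    have "norm (S t x) \<le> (C + M * C) * norm x" if t: "t \<in> {0..real (Suc n) * \<delta>}" for t x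
    proof (cases "t \<le> real n * \<delta>")
      case True
      have "norm (S t x) \<le> C * norm x" using C(2) t True by auto
      also have "\<dots> \<le> (C + M * C) * norm x"
        using C(1) \<delta>(2) by (intro mult_right_mono) auto
      finally show ?thesis .
    next
      case False
      define r where "r = t - real n * \<delta>"
      have r: "r \<in> {0..\<delta>}" using False t by (auto simp: r_def algebra_simps)
      have "0 \<le> real n * \<delta>" using \<delta>(1) by simp
      hence "norm (S t x) = norm (S r (S (real n * \<delta>) x))"
        using c0_semigroup_add[OF S, of r "real n * \<delta>" x] r by (simp add: r_def)
      also have "\<dots> \<le> M * norm (S (real n * \<delta>) x)"
        by (rule \<delta>(3)[OF r])
      also have "\<dots> \<le> M * (C * norm x)"
        using \<delta>(1,2) by (intro mult_left_mono C) auto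
      also have "\<dots> \<le> (C + M * C) * norm x"
        using C(1) \<delta>(2) by (simp add: algebra_simps)
      finally show ?thesis .
    qed
    thus ?case using C(1) \<delta>(2) by (intro exI[of _ "C + M * C"]) auto
  qed
  moreover obtain n :: nat where "T / \<delta> \<le> n" using real_arch_simple by blast
  hence "{0..T} \<subseteq> {0..real n * \<delta>}" using \<delta>(1) by (auto simp: field_simps)
  ultimately show ?thesis by (meson subsetD)
qed

text \<open>Factoring out the smaller of the two times reduces continuity from either side to right
  continuity at 0, the factor being bounded uniformly near \<open>t\<close>.\<close>

lemma c0_semigroup_continuous_on:
  fixes S :: "real \<Rightarrow> 'a::banach \<Rightarrow> 'a"
  assumes S: "c0_semigroup S"
  shows "continuous_on {0..} (\<lambda>t. S t x)"
proof -
  have "\<exists>d>0. \<forall>s\<in>{0..}. dist s t < d \<longrightarrow> dist (S s x) (S t x) < e"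
    if t: "0 \<le> t" and e: "0 < e" for t e
  proof -
    obtain M where M: "0 \<le> M" "\<And>s y. s \<in> {0..t + 1} \<Longrightarrow> norm (S s y) \<le> M * norm y"
      using c0_semigroup_bounded_on[OF S] by blast
    have "\<forall>\<^sub>F r in at_right 0. dist (S r x) x < e / (M + 1)"
      using c0_semigroup_tendsto[OF S] M e by (intro tendstoD) auto
    then obtain d where d: "0 < d" "\<And>r. 0 < r \<Longrightarrow> r < d \<Longrightarrow> dist (S r x) x < e / (M + 1)"
      by (auto simp: eventually_at_right_field)
    have key: "dist (S b x) (S a x) < e" if "0 \<le> a" "a \<le> b" "a \<le> t + 1" "b - a < d" for a b
    proof (cases "a = b")
      case False
      interpret bounded_linear "S a" using that by (intro c0_semigroup_bounded_linear[OF S])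
      have "S b x - S a x = S a (S (b - a) x - x)"
        using c0_semigroup_add[OF S, of a "b - a" x] that by (simp add: diff)
      also have "norm \<dots> \<le> M * norm (S (b - a) x - x)"
        using that by (intro M) auto
      also have "\<dots> \<le> M * (e / (M + 1))"
        using d(2)[of "b - a"] that False M(1) by (intro mult_left_mono) (auto simp: dist_norm)
      also have "\<dots> < e" using M(1) e by (simp add: field_simps)
      finally show ?thesis by (simp add: dist_norm)
    qed (use e in simp)
    show ?thesis
    proof (intro exI[of _ "min d 1"] conjI ballI impI)
      fix s assume "s \<in> {0..}" "dist s t < min d 1"
      thus "dist (S s x) (S t x) < e"
        using key[of s t] key[of t s] t by (cases "s \<le> t") (auto simp: dist_real_def dist_commute)
    qed (use d in auto)
  qed
  thus ?thesis unfolding continuous_on_iff by auto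
qed

text \<open>Joint continuity is what makes the convolution integrand measurable, since there the
  time and the vector vary together.\<close>

lemma c0_semigroup_continuous_on_Times:
  fixes S :: "real \<Rightarrow> 'a::banach \<Rightarrow> 'a"
  assumes S: "c0_semigroup S"
  shows "continuous_on ({0..} \<times> UNIV) (\<lambda>(t, x). S t x)"
proof (rule continuous_onI)
  fix p :: "real \<times> 'a" and e :: real
  assume "p \<in> {0..} \<times> UNIV" and e: "0 < e"
  then obtain t x where p: "p = (t, x)" and t: "0 \<le> t" by auto
  obtain M where M: "0 \<le> M" "\<And>s y. s \<in> {0..t + 1} \<Longrightarrow> norm (S s y) \<le> M * norm y"
    using c0_semigroup_bounded_on[OF S] by blast
  obtain d where d: "0 < d" "\<And>s. 0 \<le> s \<Longrightarrow> dist s t < d \<Longrightarrow> dist (S s x) (S t x) < e / 2"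
    using c0_semigroup_continuous_on[OF S, of x] t e unfolding continuous_on_iff
    by (metis atLeast_iff half_gt_zero)
  define r where "r = min (min d 1) (e / (2 * (M + 1)))"
  have "dist (S s y) (S t x) \<le> e" if s: "0 \<le> s" "dist (s, y) (t, x) < r" for s y
  proof -
    have st: "dist s t < r" "dist y x < r"
      using s(2) dist_fst_le[of "(s, y)" "(t, x)"] dist_snd_le[of "(s, y)" "(t, x)"] by auto
    interpret bounded_linear "S s" by (rule c0_semigroup_bounded_linear[OF S s(1)])
    have "dist (S s y) (S s x) = norm (S s (y - x))" by (simp add: diff dist_norm)
    also have "\<dots> \<le> M * norm (y - x)"
      using st s by (intro M) (auto simp: r_def dist_real_def)
    also have "\<dots> \<le> M * (e / (2 * (M + 1)))"
      using st M(1) by (intro mult_left_mono) (auto simp: r_def dist_norm)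
    also have "\<dots> \<le> e / 2" using M(1) e by (simp add: field_simps)
    finally have "dist (S s y) (S s x) \<le> e / 2" .
    moreover have "dist (S s x) (S t x) < e / 2"
      using st s by (intro d) (auto simp: r_def)
    ultimately show ?thesis
      using dist_triangle[of "S s y" "S t x" "S s x"] by linarith
  qed
  moreover have "0 < r" using d M e by (simp add: r_def)
  ultimately show "\<exists>d>0. \<forall>q\<in>{0..} \<times> UNIV. dist q p < d \<longrightarrow>
      dist (case q of (t, x) \<Rightarrow> S t x) (case p of (t, x) \<Rightarrow> S t x) \<le> e"
    unfolding p by (intro exI[of _ r]) auto
qed

section \<open>Mild convolutions\<close>

lemma c0_semigroup_measurable:
  fixes S :: "real \<Rightarrow> 'a::{banach, second_countable_topology} \<Rightarrow> 'a"
  assumes S: "c0_semigroup S" and g: "g \<in> borel_measurable (lebesgue_on {0..t})"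
  shows "(\<lambda>s. S (t - s) (g s)) \<in> borel_measurable (lebesgue_on {0..t})"
proof -
  \<comment> \<open>Clamping negative times to 0 extends the action continuously to the whole
    product space, so that it is Borel; on \<open>{0..t}\<close> nothing changes.\<close>
  have "continuous_on UNIV ((\<lambda>(t, x). S t x) \<circ> (\<lambda>(t, x). (max 0 t, x)))"
    by (intro continuous_on_compose continuous_on_subset[OF c0_semigroup_continuous_on_Times[OF S]])
       (auto simp: split_beta intro!: continuous_intros)
  hence "(\<lambda>(t, x). S (max 0 t) x) \<in> borel_measurable borel"
    by (intro borel_measurable_continuous_onI) (simp add: comp_def split_beta)
  moreover have "(\<lambda>s. (t - s, g s)) \<in> borel_measurable (lebesgue_on {0..t})"
  proof (rule borel_measurable_Pair[OF _ g])
    show "(\<lambda>s. t - s) \<in> borel_measurable (lebesgue_on {0..t})"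
      by (intro continuous_imp_measurable_on_sets_lebesgue continuous_intros) auto
  qed
  ultimately have "(\<lambda>s. S (max 0 (t - s)) (g s)) \<in> borel_measurable (lebesgue_on {0..t})"
    by (rule measurable_compose_rev[THEN measurable_cong[THEN iffD1, rotated]]) simp
  thus ?thesis
    by (rule measurable_cong[THEN iffD1, rotated]) (auto simp: max_def)
qed

lemma set_borel_measurable_lebesgue_on:
  fixes g :: "'a::euclidean_space \<Rightarrow> 'b::real_normed_vector"
  assumes "A \<in> sets lebesgue"
  shows "set_borel_measurable lebesgue A g \<longleftrightarrow> g \<in> borel_measurable (lebesgue_on A)"
  using assms unfolding set_borel_measurable_def by (subst borel_measurable_restrict_space_iff) auto

lemma set_integrable_imp_borel_measurable:
  fixes g :: "'a::euclidean_space \<Rightarrow> 'b::{banach, second_countable_topology}"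
  assumes "set_integrable lebesgue A g" "A \<in> sets lebesgue"
  shows "g \<in> borel_measurable (lebesgue_on A)"
  using assms set_borel_measurable_lebesgue_on[of A g]
  by (simp add: set_integrable_def set_borel_measurable_def borel_measurable_integrable)

lemma c0_semigroup_convolution_integrable:
  fixes S :: "real \<Rightarrow> 'a::{banach, second_countable_topology} \<Rightarrow> 'a"
  assumes S: "c0_semigroup S" and g: "set_integrable lebesgue {0..T} g" and t: "t \<in> {0..T}"
  shows "set_integrable lebesgue {0..t} (\<lambda>s. S (t - s) (g s))"
proof -
  obtain M where M: "0 \<le> M" "\<And>s y. s \<in> {0..T} \<Longrightarrow> norm (S s y) \<le> M * norm y"
    using c0_semigroup_bounded_on[OF S] by blast
  have gt: "set_integrable lebesgue {0..t} g"
    using t by (intro set_integrable_subset[OF g]) auto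
  show ?thesis
  proof (rule set_integrable_bound)
    show "set_integrable lebesgue {0..t} (\<lambda>s. M *\<^sub>R g s)"
      using gt by simp
    show "set_borel_measurable lebesgue {0..t} (\<lambda>s. S (t - s) (g s))"
      using set_integrable_imp_borel_measurable[OF gt] c0_semigroup_measurable[OF S]
      by (simp add: set_borel_measurable_lebesgue_on)
    show "AE s in lebesgue. s \<in> {0..t} \<longrightarrow> norm (S (t - s) (g s)) \<le> norm (M *\<^sub>R g s)"
      using t M by auto
  qed
qed

text \<open>Extension by zero moves the variable upper limit into the integrand \<open>k\<close>,
  and dominated convergence with majorant \<open>M * norm (g s)\<close> handles limit and kernel at
  once.\<close>

lemma continuous_on_c0_semigroup_convolution:
  fixes S :: "real \<Rightarrow> 'a::{banach, second_countable_topology} \<Rightarrow> 'a"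
  assumes S: "c0_semigroup S" and g: "set_integrable lebesgue {0..T} g"
  shows "continuous_on {0..T} (\<lambda>t. LINT s:{0..t}|lebesgue. S (t - s) (g s))"
proof -
  obtain M where M: "0 \<le> M" "\<And>s y. s \<in> {0..T} \<Longrightarrow> norm (S s y) \<le> M * norm y"
    using c0_semigroup_bounded_on[OF S] by blast
  define k where "k t s = indicator {0..t} s *\<^sub>R S (t - s) (g s)" for t s :: real
  have k: "integrable lebesgue (k t)" if "t \<in> {0..T}" for t
    using c0_semigroup_convolution_integrable[OF S g that] by (simp add: k_def[abs_def] set_integrable_def)
  have "(\<lambda>n. LINT s|lebesgue. k (\<tau> n) s) \<longlonglongrightarrow> (LINT s|lebesgue. k t s)"
    if \<tau>: "\<And>n. \<tau> n \<in> {0..T}" and t: "t \<in> {0..T}" and lim: "\<tau> \<longlonglongrightarrow> t" for \<tau> t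
  proof (rule integral_dominated_convergence)
    show "k t \<in> borel_measurable lebesgue" "\<And>n. k (\<tau> n) \<in> borel_measurable lebesgue"
      using k \<tau> t by auto
    show "integrable lebesgue (\<lambda>s. M * norm (indicator {0..T} s *\<^sub>R g s))"
      using g unfolding set_integrable_def by (intro integrable_mult_right integrable_norm)
    show "AE s in lebesgue. norm (k (\<tau> n) s) \<le> M * norm (indicator {0..T} s *\<^sub>R g s)" for n
      using \<tau>[of n] M by (auto simp: k_def indicator_def)
    \<comment> \<open>Away from \<open>s = t\<close> the indicator is eventually constant; at
      \<open>s = t\<close> it may oscillate, but a single point is null.\<close>
    have "(\<lambda>n. k (\<tau> n) s) \<longlonglongrightarrow> k t s" if "s \<noteq> t" for s
    proof (cases "0 \<le> s \<and> s < t")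
      case True
      have "(\<lambda>n. S (\<tau> n - s) (g s)) \<longlonglongrightarrow> S (t - s) (g s)"
      proof -
        have ev: "\<forall>\<^sub>F n in sequentially. \<tau> n - s \<in> {0..}"
          using order_tendstoD(1)[OF lim, of s] True by (auto elim: eventually_mono)
        have "(\<lambda>n. \<tau> n - s) \<longlonglongrightarrow> t - s" by (intro tendsto_intros lim)
        thus ?thesis
          using continuous_on_tendsto_compose[OF c0_semigroup_continuous_on[OF S, of "g s"] _ _ ev] True
          by auto
      qed
      moreover have "\<forall>\<^sub>F n in sequentially. S (\<tau> n - s) (g s) = k (\<tau> n) s"
        using order_tendstoD(1)[OF lim, of s] True
        by (auto elim!: eventually_mono simp: k_def)
      ultimately show ?thesis
        using True by (simp add: k_def[of t] tendsto_cong)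
    next
      case False
      have "\<forall>\<^sub>F n in sequentially. k (\<tau> n) s = 0"
      proof (cases "0 \<le> s")
        case True
        hence "t < s" using False that by auto
        thus ?thesis
          using order_tendstoD(2)[OF lim, of s] by (auto elim!: eventually_mono simp: k_def)
      qed (auto simp: k_def)
      moreover have "k t s = 0"
        using False that by (auto simp: k_def indicator_def)
      ultimately show ?thesis by (simp add: tendsto_eventually)
    qed
    moreover have "AE s in lebesgue. s \<noteq> t"
      by (rule AE_completion) (rule AE_lborel_singleton)
    ultimately show "AE s in lebesgue. (\<lambda>n. k (\<tau> n) s) \<longlonglongrightarrow> k t s"
      by (auto elim!: eventually_mono)
  qed
  thus ?thesis
    unfolding continuous_on_sequentially comp_def set_lebesgue_integral_def k_def by blast
qed

text \<open>Integrating the weight produces the factor \<open>1 / lam\<close>, which makes the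
  Picard map contract for large \<open>lam\<close> whatever the length of the interval.\<close>

lemma norm_c0_semigroup_convolution_diff_le:
  fixes S :: "real \<Rightarrow> 'a::{banach, second_countable_topology} \<Rightarrow> 'a"
  assumes S: "c0_semigroup S" and t: "t \<in> {0..T}" and lam: "0 < lam"
    and M: "\<And>s y. s \<in> {0..T} \<Longrightarrow> norm (S s y) \<le> M * norm y" "0 \<le> M"
    and g: "set_integrable lebesgue {0..T} g1" "set_integrable lebesgue {0..T} g2"
    and le: "\<And>s. s \<in> {0..T} \<Longrightarrow> norm (g1 s - g2 s) \<le> B * exp (lam * s)" and B: "0 \<le> B"
  shows "norm ((LINT s:{0..t}|lebesgue. S (t - s) (g1 s)) - (LINT s:{0..t}|lebesgue. S (t - s) (g2 s)))
    \<le> M * B / lam * exp (lam * t)"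
proof -
  have int: "set_integrable lebesgue {0..t} (\<lambda>s. S (t - s) (g1 s))"
    "set_integrable lebesgue {0..t} (\<lambda>s. S (t - s) (g2 s))"
    using c0_semigroup_convolution_integrable[OF S _ t] g by auto
  have "((\<lambda>s. exp (lam * s)) has_integral (exp (lam * t) / lam - exp (lam * 0) / lam)) {0..t}"
    using t lam
    by (intro fundamental_theorem_of_calculus)
       (auto intro!: derivative_eq_intros simp flip: has_real_derivative_iff_has_vector_derivative)
  hence has: "((\<lambda>s. M * B * exp (lam * s)) has_integral M * B * (exp (lam * t) / lam - exp (lam * 0) / lam)) {0..t}"
    by (rule has_integral_mult_right)
  have expint: "set_integrable lebesgue {0..t} (\<lambda>s. M * B * exp (lam * s))"
    using has M(2) B
    by (intro nonnegative_absolutely_integrable_1) (auto simp: has_integral_integrable)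
  have "norm ((LINT s:{0..t}|lebesgue. S (t - s) (g1 s)) - (LINT s:{0..t}|lebesgue. S (t - s) (g2 s)))
      = norm (LINT s:{0..t}|lebesgue. S (t - s) (g1 s) - S (t - s) (g2 s))"
    using int by simp
  also have "\<dots> \<le> (LINT s:{0..t}|lebesgue. norm (S (t - s) (g1 s) - S (t - s) (g2 s)))"
    unfolding set_lebesgue_integral_def
    using integral_norm_bound[of lebesgue "\<lambda>s. indicator {0..t} s *\<^sub>R (S (t - s) (g1 s) - S (t - s) (g2 s))"]
    by simp
  also have "\<dots> \<le> (LINT s:{0..t}|lebesgue. M * B * exp (lam * s))"
  proof (rule set_integral_mono[OF _ expint])
    show "set_integrable lebesgue {0..t} (\<lambda>s. norm (S (t - s) (g1 s) - S (t - s) (g2 s)))"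
      using int by (intro set_integrable_norm set_integral_diff)
    fix s assume s: "s \<in> {0..t}"
    interpret bounded_linear "S (t - s)"
      using s by (intro c0_semigroup_bounded_linear[OF S]) auto
    have "norm (S (t - s) (g1 s) - S (t - s) (g2 s)) \<le> M * norm (g1 s - g2 s)"
      using M(1)[of "t - s" "g1 s - g2 s"] s t by (simp add: diff)
    also have "\<dots> \<le> M * (B * exp (lam * s))"
      using s t M(2) by (intro mult_left_mono le) auto
    finally show "norm (S (t - s) (g1 s) - S (t - s) (g2 s)) \<le> M * B * exp (lam * s)"
      by (simp add: mult.assoc)
  qed
  also have "\<dots> = M * B * (exp (lam * t) / lam - exp (lam * 0) / lam)"
    by (rule trans[OF set_lebesgue_integral_eq_integral(2)[OF expint] integral_unique[OF has]])
  also have "\<dots> \<le> M * B * (exp (lam * t) / lam)"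
    using M(2) B lam by (intro mult_left_mono) auto
  finally show ?thesis by simp
qed

text \<open>
  The contraction principle is applied to the rescaled unknown \<open>exp (- lam * t) *\<^sub>R x t\<close>, which makes the Picard
  map a contraction on all of \<open>[0,T]\<close>; functions on \<open>[0,T]\<close> are extended to the real line by clamping.
\<close>

theorem semilinear_mild_solution:
  fixes S :: "real \<Rightarrow> 'a::{banach, second_countable_topology} \<Rightarrow> 'a"
  assumes T: "0 \<le> T" and S: "c0_semigroup S"
    and lip: "\<And>t z1 z2. t \<in> {0..T} \<Longrightarrow> norm (G t z1 - G t z2) \<le> L * norm (z1 - z2)" and L: "0 \<le> L"
    and int: "\<And>x. continuous_on {0..T} x \<Longrightarrow> set_integrable lebesgue {0..T} (\<lambda>s. G s (x s))"
  shows "\<exists>x. continuous_on {0..T} x \<and> mild_equation T S x0 (\<lambda>s. G s (x s)) x \<and>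
    (\<forall>x'. continuous_on {0..T} x' \<longrightarrow> mild_equation T S x0 (\<lambda>s. G s (x' s)) x' \<longrightarrow>
       (\<forall>t\<in>{0..T}. x' t = x t))"
proof -
  obtain M where M: "0 \<le> M" "\<And>s y. s \<in> {0..T} \<Longrightarrow> norm (S s y) \<le> M * norm y"
    using c0_semigroup_bounded_on[OF S] by blast
  \<comment> \<open>Chosen so that \<open>M * L / lam \<le> 1 / 2\<close>; the summand 1 keeps it
    positive when \<open>M * L = 0\<close>.\<close>
  define lam where "lam = 2 * (M * L) + 1"
  have lam: "0 < lam" using M(1) L by (simp add: lam_def add_nonneg_pos)
  define c where "c t = max 0 (min t T)" for t
  have c_cont: "continuous_on A c" for A
    unfolding c_def by (intro continuous_intros)
  have c_mem: "c t \<in> {0..T}" for t using T by (auto simp: c_def)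
  have c_id: "c t = t" if "t \<in> {0..T}" for t using that by (auto simp: c_def)
  define \<Gamma> where "\<Gamma> x t = S t x0 + (LINT s:{0..t}|lebesgue. S (t - s) (G s (x s)))" for x t
  have \<Gamma>_cont: "continuous_on {0..T} (\<Gamma> x)" if "continuous_on {0..T} x" for x
    unfolding \<Gamma>_def[abs_def]
    using continuous_on_subset[OF c0_semigroup_continuous_on[OF S]]
      continuous_on_c0_semigroup_convolution[OF S int[OF that]]
    by (intro continuous_on_add) auto
  have \<Gamma>_cong: "\<Gamma> x t = \<Gamma> x' t" if "t \<in> {0..T}" "\<And>s. s \<in> {0..T} \<Longrightarrow> x s = x' s" for x x' t
    unfolding \<Gamma>_def using that by (auto intro!: arg_cong2[of _ _ _ _ "(+)"] set_lebesgue_integral_cong)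
  have mild_iff: "mild_equation T S x0 (\<lambda>s. G s (x s)) x \<longleftrightarrow> (\<forall>t\<in>{0..T}. x t = \<Gamma> x t)"
    if "continuous_on {0..T} x" for x
    unfolding mild_equation_def \<Gamma>_def
    using c0_semigroup_convolution_integrable[OF S int[OF that]] by auto
  \<comment> \<open>Passage to the complete space of bounded continuous functions on the line:
    weight, then extend constantly beyond \<open>[0,T]\<close>. \<open>X\<close> below removes the
    weight and inverts this on \<open>[0,T]\<close>.\<close>
  define E where "E x t = exp (- lam * c t) *\<^sub>R x (c t)" for x :: "real \<Rightarrow> 'a" and t
  have E: "E x \<in> bcontfun" if "continuous_on {0..T} x" for x
  proof -
    have cont: "continuous_on {0..T} (\<lambda>t. exp (- lam * t) *\<^sub>R x t)"
      by (intro continuous_intros that)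
    have "continuous_on UNIV (E x)"
      unfolding E_def[abs_def]
      by (rule continuous_on_compose2[OF cont c_cont]) (use c_mem in auto)
    moreover have "bounded (range (E x))"
    proof (rule bounded_subset)
      show "bounded ((\<lambda>t. exp (- lam * t) *\<^sub>R x t) ` {0..T})"
        by (intro compact_imp_bounded compact_continuous_image cont) auto
      show "range (E x) \<subseteq> (\<lambda>t. exp (- lam * t) *\<^sub>R x t) ` {0..T}"
        using c_mem by (auto simp: E_def)
    qed
    ultimately show ?thesis by (simp add: bcontfun_def)
  qed
  define X where "X z t = exp (lam * t) *\<^sub>R apply_bcontfun z t" for z :: "real \<Rightarrow>\<^sub>C 'a" and t
  have X_cont: "continuous_on A (X z)" for A z
    unfolding X_def[abs_def] by (intro continuous_intros) auto
  have X_E: "X (Bcontfun (E x)) t = x t" if "continuous_on {0..T} x" "t \<in> {0..T}" for x t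
    using that by (simp add: X_def Bcontfun_inverse[OF E] E_def c_id flip: exp_add)
  define \<Phi> where "\<Phi> z = Bcontfun (E (\<Gamma> (X z)))" for z
  have \<Phi>_apply: "apply_bcontfun (\<Phi> z) t = exp (- lam * c t) *\<^sub>R \<Gamma> (X z) (c t)" for z t
    unfolding \<Phi>_def by (subst Bcontfun_inverse[OF E]) (auto intro: \<Gamma>_cont X_cont simp: E_def)
  have "dist (\<Phi> z1) (\<Phi> z2) \<le> (1 / 2) * dist z1 z2" for z1 z2
  proof (rule dist_bound)
    fix t
    have "norm (G s (X z1 s) - G s (X z2 s)) \<le> (L * dist z1 z2) * exp (lam * s)" if s: "s \<in> {0..T}" for s
    proof -
      have "norm (X z1 s - X z2 s) = exp (lam * s) * dist (z1 s) (z2 s)"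
        by (simp add: X_def dist_norm flip: scaleR_diff_right)
      also have "\<dots> \<le> exp (lam * s) * dist z1 z2"
        by (intro mult_left_mono dist_bounded) auto
      finally have "L * norm (X z1 s - X z2 s) \<le> L * (exp (lam * s) * dist z1 z2)"
        using L by (rule mult_left_mono)
      thus ?thesis using lip[OF s, of "X z1 s" "X z2 s"] by (simp add: mult_ac)
    qed
    hence "norm (\<Gamma> (X z1) (c t) - \<Gamma> (X z2) (c t)) \<le> M * (L * dist z1 z2) / lam * exp (lam * c t)"
      unfolding \<Gamma>_def add_diff_cancel_left
      using L M by (intro norm_c0_semigroup_convolution_diff_le[OF S c_mem lam] int X_cont) auto
    hence "exp (- lam * c t) * norm (\<Gamma> (X z1) (c t) - \<Gamma> (X z2) (c t)) \<le>
        exp (- lam * c t) * (M * (L * dist z1 z2) / lam * exp (lam * c t))"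
      by (intro mult_left_mono) auto
    also have "\<dots> = M * L / lam * dist z1 z2"
      by (simp add: exp_minus)
    also have "\<dots> \<le> 1 / 2 * dist z1 z2"
      using lam by (intro mult_right_mono) (auto simp: lam_def field_simps)
    finally show "dist (\<Phi> z1 t) (\<Phi> z2 t) \<le> 1 / 2 * dist z1 z2"
      by (simp add: \<Phi>_apply dist_norm flip: scaleR_diff_right)
  qed
  hence "\<exists>!z. \<Phi> z = z"
    by (intro banach_fix_type[of "1 / 2"]) auto
  then obtain z where z: "\<Phi> z = z" and unique: "\<And>z'. \<Phi> z' = z' \<Longrightarrow> z' = z" by blast
  have "X z t = \<Gamma> (X z) t" if "t \<in> {0..T}" for t
  proof -
    have "X z t = exp (lam * t) *\<^sub>R apply_bcontfun (\<Phi> z) t" by (simp add: X_def z)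
    also have "\<dots> = \<Gamma> (X z) t"
      by (simp add: \<Phi>_apply c_id[OF that] flip: exp_add)
    finally show ?thesis .
  qed
  hence "mild_equation T S x0 (\<lambda>s. G s (X z s)) (X z)"
    using mild_iff[OF X_cont] by blast
  moreover have "x' t = X z t" if x': "continuous_on {0..T} x'"
    "mild_equation T S x0 (\<lambda>s. G s (x' s)) x'" and t: "t \<in> {0..T}" for x' t
  proof -
    have fixed: "\<And>t. t \<in> {0..T} \<Longrightarrow> \<Gamma> x' t = x' t"
      using x' mild_iff by auto
    \<comment> \<open>Any mild solution, once encoded by \<open>E\<close>, is a fixed point of
      \<open>\<Phi>\<close>, so uniqueness of the fixed point carries over.\<close>
    have "\<Gamma> (X (Bcontfun (E x'))) (c t) = x' (c t)" for t
      using fixed[OF c_mem] \<Gamma>_cong[OF c_mem X_E[OF x'(1)]] by simp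
    hence "E (\<Gamma> (X (Bcontfun (E x')))) = E x'" by (simp add: E_def fun_eq_iff)
    hence "\<Phi> (Bcontfun (E x')) = Bcontfun (E x')" by (simp add: \<Phi>_def)
    hence "Bcontfun (E x') = z" by (rule unique)
    thus ?thesis using X_E[OF x'(1) t] by simp
  qed
  ultimately show ?thesis using X_cont[of "{0..T}" z] by blast
qed

section \<open>Reduction of the coupled system\<close>

text \<open>Replacing \<open>w\<close> by its values at grid points leaves countably many frozen
  second arguments, each measurable in time; continuity of \<open>\<phi> t\<close> recovers the
  composition as the grid is refined.\<close>

lemma borel_measurable_caratheodory_compose:
  fixes \<phi> :: "real \<Rightarrow> 'b::topological_space \<Rightarrow> 'a::metric_space"
  assumes T: "0 \<le> T" and meas: "\<And>z. (\<lambda>t. \<phi> t z) \<in> borel_measurable (lebesgue_on {0..T})"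
    and cont: "\<And>t. t \<in> {0..T} \<Longrightarrow> continuous_on UNIV (\<phi> t)"
    and w: "continuous_on {0..T} w"
  shows "(\<lambda>t. \<phi> t (w t)) \<in> borel_measurable (lebesgue_on {0..T})"
proof (rule borel_measurable_LIMSEQ_metric)
  define c where "c t = max 0 (min t T)" for t
  define r where "r n t = \<lfloor>real (Suc n) * t\<rfloor>" for n t
  \<comment> \<open>The index \<open>k\<close> ranges over all integers, so grid points are clamped
    into \<open>[0,T]\<close>, where \<open>w\<close> is known to be continuous.\<close>
  define \<tau> where "\<tau> n k = c (real_of_int k / real (Suc n))" for n k
  have \<tau>: "\<tau> n k \<in> {0..T}" for n k using T by (auto simp: \<tau>_def c_def)
  show "(\<lambda>t. \<phi> t (w (\<tau> n (r n t)))) \<in> borel_measurable (lebesgue_on {0..T})" for n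
  proof (rule measurable_compose_countable[where f = "\<lambda>k t. \<phi> t (w (\<tau> n k))" and g = "r n"])
    have "(\<lambda>t. real (Suc n) * t) \<in> borel_measurable (lebesgue_on {0..T})"
      by (intro continuous_imp_measurable_on_sets_lebesgue continuous_intros) auto
    from measurable_compose[OF this measurable_real_floor]
    show "r n \<in> measurable (lebesgue_on {0..T}) (count_space UNIV)"
      by (simp add: r_def[abs_def])
  qed (rule meas)
  fix t assume "t \<in> space (lebesgue_on {0..T})"
  hence t: "t \<in> {0..T}" by simp
  have lim: "(\<lambda>n. \<tau> n (r n t)) \<longlonglongrightarrow> t"
  proof -
    have "(\<lambda>n. real_of_int (r n t) / real (Suc n)) \<longlonglongrightarrow> t"
    proof (rule tendsto_sandwich[OF _ _ _ tendsto_const])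
      show "(\<lambda>n. t - 1 / real (Suc n)) \<longlonglongrightarrow> t"
        using tendsto_diff[OF tendsto_const LIMSEQ_inverse_real_of_nat, of t]
        by (simp add: inverse_eq_divide)
      show "\<forall>\<^sub>F n in sequentially. t - 1 / real (Suc n) \<le> real_of_int (r n t) / real (Suc n)"
      proof (intro always_eventually allI)
        fix n
        have "real (Suc n) * t - 1 \<le> real_of_int (r n t)"
          unfolding r_def by linarith
        hence "(real (Suc n) * t - 1) / real (Suc n) \<le> real_of_int (r n t) / real (Suc n)"
          by (intro divide_right_mono) auto
        thus "t - 1 / real (Suc n) \<le> real_of_int (r n t) / real (Suc n)"
          by (simp add: diff_divide_distrib del: of_nat_Suc)
      qed
      show "\<forall>\<^sub>F n in sequentially. real_of_int (r n t) / real (Suc n) \<le> t"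
      proof (intro always_eventually allI)
        fix n
        have "real_of_int (r n t) \<le> real (Suc n) * t"
          unfolding r_def by linarith
        thus "real_of_int (r n t) / real (Suc n) \<le> t"
          by (simp add: field_simps del: of_nat_Suc)
      qed
    qed
    hence "(\<lambda>n. c (real_of_int (r n t) / real (Suc n))) \<longlonglongrightarrow> c t"
      unfolding c_def by (intro tendsto_intros)
    thus ?thesis using t by (simp add: \<tau>_def c_def)
  qed
  have "(\<lambda>n. w (\<tau> n (r n t))) \<longlonglongrightarrow> w t"
    using continuous_on_tendsto_compose[OF w lim t] \<tau> by simp
  thus "(\<lambda>n. \<phi> t (w (\<tau> n (r n t)))) \<longlonglongrightarrow> \<phi> t (w t)"
    using continuous_on_tendsto_compose[OF cont[OF t]] by simp
qed

lemma frozen_solution_iff_normal_cone: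
  "u \<in> (\<lambda>\<xi>. h t x u - \<xi>) ` normal_cone (K t) (P u) \<longleftrightarrow> frozen_solution P K h t x u"
proof
  assume "u \<in> (\<lambda>\<xi>. h t x u - \<xi>) ` normal_cone (K t) (P u)"
  then obtain \<xi> where \<xi>: "\<xi> \<in> normal_cone (K t) (P u)" "u = h t x u - \<xi>" by blast
  have "\<xi> = h t x u - (h t x u - \<xi>)" by simp
  also have "h t x u - \<xi> = u" using \<xi>(2) by simp
  finally show "frozen_solution P K h t x u"
    using \<xi>(1) by (auto simp: normal_cone_def frozen_solution_def split: if_splits)
next
  assume "frozen_solution P K h t x u"
  hence "h t x u - u \<in> normal_cone (K t) (P u)"
    by (simp add: normal_cone_def frozen_solution_def)
  thus "u \<in> (\<lambda>\<xi>. h t x u - \<xi>) ` normal_cone (K t) (P u)"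
    by (intro image_eqI[of _ _ "h t x u - u"]) auto
qed

text \<open>The coincidence set is closed and has full measure in an open interval, so it contains
  the interval and then its endpoints.\<close>

lemma continuous_eq_if_AE_eq:
  fixes v w :: "real \<Rightarrow> 'a::real_normed_vector"
  assumes T: "0 < T" and v: "continuous_on {0..T} v" and w: "continuous_on {0..T} w"
    and eq: "AE t in lebesgue_on {0<..<T}. v t = w t" and t: "t \<in> {0..T}"
  shows "v t = w t"
proof -
  define C where "C = {t \<in> {0..T}. v t - w t = 0}"
  have "closed C"
    unfolding C_def using v w by (intro continuous_closed_preimage_constant continuous_intros) auto
  have AE_C: "AE t \<in> {0<..<T} in lebesgue. t \<in> C"
    using eq by (simp add: AE_restrict_space_iff C_def)
  have "{0<..<T} \<subseteq> C"
    by (rule subsetI) (rule mem_closed_if_AE_lebesgue_open[OF open_greaterThanLessThan \<open>closed C\<close> AE_C])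
  hence "closure {0<..<T} \<subseteq> C"
    using \<open>closed C\<close> by (rule closure_minimal)
  thus ?thesis using T t by (auto simp: closure_greaterThanLessThan C_def)
qed

lemma mild_equation_cong:
  assumes "\<And>s. s \<in> {0..T} \<Longrightarrow> g s = g' s"
  shows "mild_equation T S x0 g x \<longleftrightarrow> mild_equation T S x0 g' x"
proof -
  have eq: "S (t - s) (g s) = S (t - s) (g' s)" if "t \<in> {0..T}" "s \<in> {0..t}" for t s
    using that assms by simp
  have "set_integrable lebesgue {0..t} (\<lambda>s. S (t - s) (g s)) =
      set_integrable lebesgue {0..t} (\<lambda>s. S (t - s) (g' s))" if "t \<in> {0..T}" for t
    by (rule set_integrable_cong[OF refl refl eq[OF that]])
  moreover have "(LINT s:{0..t}|lebesgue. S (t - s) (g s)) = (LINT s:{0..t}|lebesgue. S (t - s) (g' s))"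
    if "t \<in> {0..T}" for t
    by (rule set_lebesgue_integral_cong) (simp, use eq[OF that] in blast)
  ultimately show ?thesis unfolding mild_equation_def by simp
qed

theorem theorem4p3:
  fixes T \<gamma> L\<^sub>F \<alpha>\<^sub>h \<alpha>\<^sub>f \<beta>\<^sub>f :: real
    and D :: "'a::{real_inner, banach, second_countable_topology} set"
    and A P :: "'a \<Rightarrow> 'a"
    and S :: "real \<Rightarrow> 'a \<Rightarrow> 'a"
    and K :: "real \<Rightarrow> 'a set"
    and f h :: "real \<Rightarrow> 'a \<Rightarrow> 'a \<Rightarrow> 'a"
    and x0 :: 'a
  assumes T: "T > 0"
    and semigroup: "c0_semigroup S" and generator: "is_generator D A S"
    and P: "bounded_linear P" "self_adjoint P" "coercive P"
    and K: "\<forall>t\<in>{0..T}. K t \<noteq> {} \<and> closed (K t) \<and> convex (K t)"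
    and f_car: "caratheodory T (\<lambda>t (x, u). f t x u)"
    and h_car: "caratheodory T (\<lambda>t (x, u). h t x u)"
    and f_L1: "set_integrable lebesgue {0..T} (\<lambda>t. f t 0 0)"
    and const_F: "\<gamma> > 0" "L\<^sub>F > 0"
    and pseudomonotone: "\<forall>t\<in>{0..T}. \<forall>x.
          strongly_pseudomonotone_on (K t) \<gamma> (vi_operator P h t x) \<and>
          L\<^sub>F-lipschitz_on UNIV (vi_operator P h t x)"
    and const_h: "\<alpha>\<^sub>h > 0"
    and h_lip: "\<forall>t\<in>{0..T}. \<forall>x1 x2 u. norm (h t x1 u - h t x2 u) \<le> \<alpha>\<^sub>h * norm (x1 - x2)"
    and K_time: "time_regular_sets T K"
    and h_time: "time_regular_map T h"
    and const_f: "\<alpha>\<^sub>f > 0" "\<beta>\<^sub>f > 0"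
    and f_lip: "\<forall>t\<in>{0..T}. \<forall>x1 x2 u1 u2.
          norm (f t x1 u1 - f t x2 u2) \<le> \<alpha>\<^sub>f * norm (x1 - x2) + \<beta>\<^sub>f * norm (u1 - u2)"
  shows "\<exists>x u. mild_solution_pair T S P K f h x0 x u \<and>
           (\<forall>x' u'. mild_solution_pair T S P K f h x0 x' u' \<longrightarrow>
              (\<forall>t\<in>{0..T}. x' t = x t \<and> u' t = u t)) \<and>
           mild_equation T S x0 (\<lambda>s. reduced_rhs P K h f s (x s)) x \<and>
           (\<forall>t\<in>{0..T}. (\<exists>!w. frozen_solution P K h t (x t) w) \<and>
              u t = frozen_value P K h t (x t)) \<and>
           continuous_on {0..T} (\<lambda>t. frozen_value P K h t (x t))"
proof -
  interpret frozen_problem T \<gamma> L\<^sub>F \<alpha>\<^sub>h P K h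
    by (intro frozen_problem.intro) (use P K pseudomonotone const_F h_lip K_time h_time in blast)+
  let ?u = "frozen_value P K h"
  let ?G = "reduced_rhs P K h f"
  obtain C where C: "0 \<le> C" "\<And>t x1 x2. t \<in> {0..T} \<Longrightarrow> norm (?u t x1 - ?u t x2) \<le> C * norm (x1 - x2)"
    using frozen_value_lipschitz by blast
  have G_lip: "norm (?G t z1 - ?G t z2) \<le> (\<alpha>\<^sub>f + \<beta>\<^sub>f * C) * norm (z1 - z2)" if t: "t \<in> {0..T}" for t z1 z2
  proof -
    have "norm (?G t z1 - ?G t z2) \<le> \<alpha>\<^sub>f * norm (z1 - z2) + \<beta>\<^sub>f * norm (?u t z1 - ?u t z2)"
      unfolding reduced_rhs_def using f_lip t by blast
    also have "\<dots> \<le> \<alpha>\<^sub>f * norm (z1 - z2) + \<beta>\<^sub>f * (C * norm (z1 - z2))"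
      using C(2)[OF t] const_f by (intro add_left_mono mult_left_mono) auto
    finally show ?thesis by (simp add: algebra_simps)
  qed
  have G_int: "set_integrable lebesgue {0..T} (\<lambda>s. ?G s (x s))" if x: "continuous_on {0..T} x" for x
  proof -
    define w where "w s = (x s, ?u s (x s))" for s
    have w: "continuous_on {0..T} w"
      unfolding w_def by (intro continuous_intros x continuous_on_frozen_value)
    have f_meas: "(\<lambda>s. (\<lambda>(x, u). f s x u) z) \<in> borel_measurable (lebesgue_on {0..T})" for z
      using f_car unfolding caratheodory_def by blast
    \<comment> \<open>The Lipschitz bound holds at every time, which upgrades the almost-everywhere
      continuity of the Caratheodory condition to the pointwise one used for sampling.\<close>
    have f_cont: "continuous_on UNIV (\<lambda>(x, u). f t x u)" if t: "t \<in> {0..T}" for t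
    proof (rule lipschitz_on_continuous_on[OF lipschitz_onI])
      fix p q :: "'a \<times> 'a"
      have "dist (f t (fst p) (snd p)) (f t (fst q) (snd q)) \<le>
          \<alpha>\<^sub>f * dist (fst p) (fst q) + \<beta>\<^sub>f * dist (snd p) (snd q)"
        unfolding dist_norm using f_lip t by blast
      also have "\<dots> \<le> \<alpha>\<^sub>f * dist p q + \<beta>\<^sub>f * dist p q"
        using const_f by (intro add_mono mult_left_mono dist_fst_le dist_snd_le) auto
      finally show "dist (case p of (x, u) \<Rightarrow> f t x u) (case q of (x, u) \<Rightarrow> f t x u) \<le>
          (\<alpha>\<^sub>f + \<beta>\<^sub>f) * dist p q"
        by (simp add: split_beta algebra_simps)
    qed (use const_f in auto)
    have "(\<lambda>s. (\<lambda>(x, u). f s x u) (w s)) \<in> borel_measurable (lebesgue_on {0..T})"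
      by (rule borel_measurable_caratheodory_compose[OF less_imp_le[OF T] f_meas f_cont w])
    hence meas: "set_borel_measurable lebesgue {0..T} (\<lambda>s. ?G s (x s))"
      by (simp add: set_borel_measurable_lebesgue_on w_def reduced_rhs_def)
    \<comment> \<open>The curve \<open>w\<close> has compact image, so \<open>f\<close> along it is
      dominated by \<open>norm (f s 0 0)\<close> plus a constant, integrable on
      \<open>[0,T]\<close>.\<close>
    have "bounded (w ` {0..T})"
      using w by (intro compact_imp_bounded compact_continuous_image) auto
    then obtain B where B: "\<And>s. s \<in> {0..T} \<Longrightarrow> norm (w s) \<le> B"
      unfolding bounded_iff by blast
    have le: "norm (?G s (x s)) \<le> norm (norm (f s 0 0) + (\<alpha>\<^sub>f * B + \<beta>\<^sub>f * B))" if s: "s \<in> {0..T}" for s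
    proof -
      have "norm (f s (x s) (?u s (x s)) - f s 0 0) \<le>
          \<alpha>\<^sub>f * norm (x s - 0) + \<beta>\<^sub>f * norm (?u s (x s) - 0)"
        using f_lip s by blast
      also have "\<dots> \<le> \<alpha>\<^sub>f * B + \<beta>\<^sub>f * B"
        using const_f order_trans[OF norm_fst_le B[OF s, unfolded w_def]]
          order_trans[OF norm_snd_le B[OF s, unfolded w_def]]
        by (intro add_mono mult_left_mono) auto
      finally show ?thesis
        using norm_triangle_sub[of "?G s (x s)" "f s 0 0"] by (simp add: reduced_rhs_def)
    qed
    have "set_integrable lebesgue {0..T} (\<lambda>s. norm (f s 0 0) + (\<alpha>\<^sub>f * B + \<beta>\<^sub>f * B))"
      by (intro set_integral_add set_integrable_norm f_L1) (auto simp: absolutely_integrable_on_const)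
    thus ?thesis
      by (rule set_integrable_bound) (use meas le in auto)
  qed
  have G_const: "0 \<le> \<alpha>\<^sub>f + \<beta>\<^sub>f * C"
    using C(1) const_f by simp
  obtain x where x: "continuous_on {0..T} x" "mild_equation T S x0 (\<lambda>s. ?G s (x s)) x"
    and unique: "\<And>x' t. continuous_on {0..T} x' \<Longrightarrow> mild_equation T S x0 (\<lambda>s. ?G s (x' s)) x' \<Longrightarrow>
      t \<in> {0..T} \<Longrightarrow> x' t = x t"
    using semilinear_mild_solution[OF less_imp_le[OF T] semigroup G_lip G_const G_int, of x0] by blast
  define u where "u t = ?u t (x t)" for t
  have u_cont: "continuous_on {0..T} u"
    unfolding u_def by (rule continuous_on_frozen_value[OF x(1)])
  have incl: "AE t in lebesgue_on {0<..<T}.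
      u t \<in> (\<lambda>\<xi>. h t (x t) (u t) - \<xi>) ` normal_cone (K t) (P (u t))"
  proof (rule AE_I2)
    fix t assume "t \<in> space (lebesgue_on {0<..<T})"
    hence "t \<in> {0..T}" by simp
    thus "u t \<in> (\<lambda>\<xi>. h t (x t) (u t) - \<xi>) ` normal_cone (K t) (P (u t))"
      unfolding frozen_solution_iff_normal_cone u_def by (rule frozen_solution_frozen_value)
  qed
  have "mild_equation T S x0 (\<lambda>s. f s (x s) (u s)) x"
    using x(2) by (simp add: u_def reduced_rhs_def)
  hence "mild_solution_pair T S P K f h x0 x u"
    unfolding mild_solution_pair_def using x(1) u_cont incl by blast
  moreover have "\<forall>t\<in>{0..T}. x' t = x t \<and> u' t = u t"
    if pair: "mild_solution_pair T S P K f h x0 x' u'" for x' u'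
  proof -
    have x': "continuous_on {0..T} x'" and u': "continuous_on {0..T} u'"
      and mild: "mild_equation T S x0 (\<lambda>s. f s (x' s) (u' s)) x'"
      and incl: "AE t in lebesgue_on {0<..<T}. frozen_solution P K h t (x' t) (u' t)"
      using pair unfolding mild_solution_pair_def frozen_solution_iff_normal_cone by auto
    have "AE t in lebesgue_on {0<..<T}. u' t = ?u t (x' t)"
      using incl AE_space
    proof eventually_elim
      case (elim t)
      hence "t \<in> {0..T}" by simp
      thus ?case using frozen_value_eq elim(1) by simp
    qed
    hence u'_eq: "u' t = ?u t (x' t)" if "t \<in> {0..T}" for t
      using continuous_eq_if_AE_eq[OF T u' continuous_on_frozen_value[OF x'] _ that] by blast
    \<comment> \<open>Once \<open>u'\<close> is expressed through \<open>x'\<close>, the mild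
      equation of the pair is the reduced one, whose solution is unique.\<close>
    have "mild_equation T S x0 (\<lambda>s. ?G s (x' s)) x'"
      using mild mild_equation_cong[of T "\<lambda>s. f s (x' s) (u' s)" "\<lambda>s. ?G s (x' s)"] u'_eq
      by (simp add: reduced_rhs_def)
    hence "x' t = x t" if "t \<in> {0..T}" for t
      using unique[OF x'] that by blast
    thus ?thesis using u'_eq by (simp add: u_def)
  qed
  hence "\<forall>x' u'. mild_solution_pair T S P K f h x0 x' u' \<longrightarrow> (\<forall>t\<in>{0..T}. x' t = x t \<and> u' t = u t)"
    by blast
  moreover have "\<forall>t\<in>{0..T}. (\<exists>!w. frozen_solution P K h t (x t) w) \<and> u t = ?u t (x t)"
    by (intro ballI conjI frozen_solution_ex1 u_def)
  moreover have "continuous_on {0..T} (\<lambda>t. ?u t (x t))"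
    by (rule continuous_on_frozen_value[OF x(1)])
  ultimately show ?thesis
    using x(2) by (intro exI[of _ x] exI[of _ u] conjI)
qed

end
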